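(* Let $r\ge 1$ be an integer and let $(X,T,R)$ be a reversal system of order $2r$ such that $f_\alpha(H)$ is finite for every finite-index subgroup $H$ of $G_{2r}$, where $\alpha$ is the associated action of $G_{2r}$ on $X$. Then, as formal power series in $t$, the Lind zeta function $\zeta_{T,R}=\zeta_\alpha$ of $(X,T,R)$ is given by $$\zeta_{T, R}(t) = \prod_{\substack{k\mid r \\ 1 \leq k \leq r}} \exp \left(\frac{g_{2k}(t^{2k})}{2k} \right)\prod_{\substack{2k-1\mid r \\ 1 \leq 2k-1 \leq r} }\exp \left( \frac{h_{4k-2}(t^{2k-1})}{2k-1} \right),$$ where the first product is over all positive divisors $k$ of $r$, the second is over all positive integers $k$ such that $2k-1$ divides $r$, and $g_{2k}$, $h_{4k-2}$ are the generating functions of the subsystems $(X_{2k},T,R)$ and $(X_{4k-2},T,R^{2k-1})$ respectively.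
   Context: An invertible dynamical system $(X,T)$ is a topological space $X$ with a homeomorphism $T:X\to X$. A reversal for $(X,T)$ is a homeomorphism $R:X\to X$ with $T\circ R=R\circ T^{-1}$; then $(X,T,R)$ is a reversal system, and it has order $2r$ if $2r$ is the least positive integer $n$ with $R^n=\mathrm{id}_X$. Let $G_{2r}=\langle a,b : ab=ba^{-1},\ b^{2r}=1\rangle$. A reversal system $(X,T,R)$ of order $2r$ determines the unique action $\alpha: G_{2r}\curvearrowright X$ with $\alpha(a,x)=T(x)$ and $\alpha(b,x)=R(x)$. For a finite-index subgroup $H$ of $G_{2r}$ put $f_\alpha(H)=|\{x\in X: \alpha(h,x)=x \text{ for all } h\in H\}|$. The Lind zeta function is the formal power series $$\zeta_\alpha(t)=\exp\left(\sum_{H}\frac{f_\alpha(H)}{|G_{2r}/H|}\,t^{|G_{2r}/H|}\right),$$ the sum being over all finite-index subgroups $H$ of $G_{2r}$; $|G_{2r}/H|$ is the index of $H$. For $1\le l\le r$ let $X_{2l}=\{x\in X: R^{2l}(x)=x\}$; the restrictions of $T$ and $R$ to $X_{2l}$ are again denoted $T$ and $R$. For a positive divisor $k$ of $r$, the generating function of $(X_{2k},T,R)$, regarded as a reversal system with $R^{2k}=\mathrm{id}$, is $$g_{2k}(t)=\sum_{m=1}^\infty\sum_{l=0}^{k-1}\frac{|\{x\in X_{2k}: T^m\circ R^{2l}(x)=x\}|}{m}\,t^m .$$ For $k\geq 1$ with $2k-1\mid r$, put $F=R^{2k-1}$ restricted to $X_{4k-2}$ (so $F^2=\mathrm{id}$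 and $T\circ F=F\circ T^{-1}$), and for integers $m\ge1$ and $n$ put $p(m,n)=|\{x\in X_{4k-2}: T^m(x)=T^n\circ F(x)=x\}|$. The generating function of $(X_{4k-2},T,R^{2k-1})$ is $$h_{4k-2}(t)=\sum_{m=1}^\infty\left(p(2m-1,0)\,t^{2m-1}+\frac{p(2m,0)+p(2m,1)}{2}\,t^{2m}\right).$$ *)

theory Defs
  imports
    "HOL-Analysis.Abstract_Topology"
    "HOL-Algebra.Group_Action"
    "HOL-Computational_Algebra.Formal_Power_Series"
begin

section \<open>Groups given by generators and relations\<close>

text \<open>A letter \<open>(g, True)\<close> stands for the generator \<open>g\<close>, and \<open>(g, False)\<close> for its formal inverse.
  A pair \<open>(u, v)\<close> of words stands for the relation \<open>u = v\<close>.\<close>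

type_synonym 'g word = "('g \<times> bool) list"

inductive word_eq :: "('g word \<times> 'g word) set \<Rightarrow> 'g word \<Rightarrow> 'g word \<Rightarrow> bool"
  for Rels where
  rel: "(u, v) \<in> Rels \<Longrightarrow> word_eq Rels u v"
| cancel: "word_eq Rels [(g, e), (g, \<not> e)] []"
| congr: "word_eq Rels u v \<Longrightarrow> word_eq Rels (p @ u @ q) (p @ v @ q)"
| refl: "word_eq Rels u u"
| sym: "word_eq Rels u v \<Longrightarrow> word_eq Rels v u"
| trans: "word_eq Rels u v \<Longrightarrow> word_eq Rels v w \<Longrightarrow> word_eq Rels u w"

definition word_class :: "('g word \<times> 'g word) set \<Rightarrow> 'g word \<Rightarrow> 'g word set" where
  "word_class Rels u = {v. word_eq Rels u v}"

definition presented_group :: "('g word \<times> 'g word) set \<Rightarrow> 'g word set monoid" where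
  "presented_group Rels =
    \<lparr>carrier = range (word_class Rels),
     monoid.mult = (\<lambda>A B. \<Union>u\<in>A. \<Union>v\<in>B. word_class Rels (u @ v)),
     one = word_class Rels []\<rparr>"

lemma word_class_eq_iff: "word_class Rels u = word_class Rels v \<longleftrightarrow> word_eq Rels u v"
proof
  assume "word_class Rels u = word_class Rels v"
  then show "word_eq Rels u v"
    unfolding word_class_def using word_eq.refl[of Rels v] by blast
next
  assume uv: "word_eq Rels u v"
  show "word_class Rels u = word_class Rels v"
    unfolding word_class_def
    using word_eq.trans[OF uv] word_eq.trans[OF word_eq.sym[OF uv]] by blast
qed

lemma word_eq_append:
  assumes "word_eq Rels u u'" "word_eq Rels v v'"
  shows "word_eq Rels (u @ v) (u' @ v')"
  using word_eq.congr[OF assms(1), of "[]" v] word_eq.congr[OF assms(2), of u' "[]"]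
  by simp (rule word_eq.trans)

lemma mult_word_class [simp]:
  "word_class Rels u \<otimes>\<^bsub>presented_group Rels\<^esub> word_class Rels v = word_class Rels (u @ v)"
proof -
  have "word_class Rels (u' @ v') = word_class Rels (u @ v)"
    if "u' \<in> word_class Rels u" "v' \<in> word_class Rels v" for u' v'
  proof -
    have "word_eq Rels u u'" "word_eq Rels v v'"
      using that by (simp_all add: word_class_def)
    from word_eq.sym[OF word_eq_append[OF this]] show ?thesis
      by (simp add: word_class_eq_iff)
  qed
  then have "word_class Rels u \<otimes>\<^bsub>presented_group Rels\<^esub> word_class Rels v =
      (\<Union>u'\<in>word_class Rels u. \<Union>v'\<in>word_class Rels v. word_class Rels (u @ v))"
    by (simp add: presented_group_def)
  moreover have "u \<in> word_class Rels u" "v \<in> word_class Rels v"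
    by (simp_all add: word_class_def word_eq.refl)
  ultimately show ?thesis
    by blast
qed

lemma one_presented_group [simp]: "\<one>\<^bsub>presented_group Rels\<^esub> = word_class Rels []"
  by (simp add: presented_group_def)

lemma carrier_presented_group: "carrier (presented_group Rels) = range (word_class Rels)"
  by (simp add: presented_group_def)

lemma word_class_in_carrier [simp, intro]: "word_class Rels u \<in> carrier (presented_group Rels)"
  by (simp add: carrier_presented_group)

definition inv_word :: "'g word \<Rightarrow> 'g word" where
  "inv_word u = rev (map (\<lambda>(g, e). (g, \<not> e)) u)"

lemma word_eq_inv_word: "word_eq Rels (inv_word u @ u) []"
proof (induction u)
  case Nil
  then show ?case by (simp add: inv_word_def word_eq.refl)
next
  case (Cons x u)
  obtain g e where x: "x = (g, e)" by fastforce
  have "word_eq Rels (inv_word u @ [(g, \<not> e), (g, \<not> \<not> e)] @ u) (inv_word u @ [] @ u)"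
    by (intro word_eq.congr word_eq.cancel)
  then show ?case
    using word_eq.trans[OF _ Cons] by (simp add: x inv_word_def)
qed

lemma group_presented_group: "group (presented_group Rels)"
proof (rule groupI)
  fix x assume "x \<in> carrier (presented_group Rels)"
  then obtain u where "x = word_class Rels u"
    unfolding carrier_presented_group by blast
  then have "word_class Rels (inv_word u) \<otimes>\<^bsub>presented_group Rels\<^esub> x = \<one>\<^bsub>presented_group Rels\<^esub>"
    by (simp add: word_class_eq_iff word_eq_inv_word)
  then show "\<exists>y\<in>carrier (presented_group Rels).
      y \<otimes>\<^bsub>presented_group Rels\<^esub> x = \<one>\<^bsub>presented_group Rels\<^esub>"
    by blast
next
  fix x y assume "x \<in> carrier (presented_group Rels)" "y \<in> carrier (presented_group Rels)"
  then obtain u v where "x = word_class Rels u" "y = word_class Rels v"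
    unfolding carrier_presented_group by blast
  then show "x \<otimes>\<^bsub>presented_group Rels\<^esub> y \<in> carrier (presented_group Rels)"
    by simp
next
  fix x y z
  assume "x \<in> carrier (presented_group Rels)" "y \<in> carrier (presented_group Rels)"
    "z \<in> carrier (presented_group Rels)"
  then obtain u v w
    where "x = word_class Rels u" "y = word_class Rels v" "z = word_class Rels w"
    unfolding carrier_presented_group by blast
  then show "x \<otimes>\<^bsub>presented_group Rels\<^esub> y \<otimes>\<^bsub>presented_group Rels\<^esub> z =
      x \<otimes>\<^bsub>presented_group Rels\<^esub> (y \<otimes>\<^bsub>presented_group Rels\<^esub> z)"
    by simp
next
  fix x assume "x \<in> carrier (presented_group Rels)"
  then obtain u where "x = word_class Rels u"
    unfolding carrier_presented_group by blast
  then show "\<one>\<^bsub>presented_group Rels\<^esub> \<otimes>\<^bsub>presented_group Rels\<^esub> x = x"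
    by simp
qed simp

fun word_value :: "('h, 'm) monoid_scheme \<Rightarrow> ('g \<Rightarrow> 'h) \<Rightarrow> 'g word \<Rightarrow> 'h" where
  "word_value H f [] = \<one>\<^bsub>H\<^esub>"
| "word_value H f ((g, e) # u) = (if e then f g else inv\<^bsub>H\<^esub> f g) \<otimes>\<^bsub>H\<^esub> word_value H f u"

lemma word_value_closed:
  assumes "group H" "range f \<subseteq> carrier H"
  shows "word_value H f u \<in> carrier H"
proof -
  interpret group H by fact
  have "f g \<in> carrier H" for g using assms(2) by auto
  then show ?thesis by (induction u) auto
qed

lemma word_value_append:
  assumes "group H" "range f \<subseteq> carrier H"
  shows "word_value H f (u @ v) = word_value H f u \<otimes>\<^bsub>H\<^esub> word_value H f v"
proof -
  interpret group H by fact
  have "f g \<in> carrier H" for g using assms(2) by auto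
  then show ?thesis
    using word_value_closed[OF assms] by (induction u) (auto simp: m_assoc)
qed

lemma word_value_cong:
  assumes "group H" "range f \<subseteq> carrier H"
    and rels: "\<And>u v. (u, v) \<in> Rels \<Longrightarrow> word_value H f u = word_value H f v"
    and "word_eq Rels u v"
  shows "word_value H f u = word_value H f v"
proof -
  interpret group H by fact
  have f: "f g \<in> carrier H" for g using assms(2) by auto
  show ?thesis
    using assms(4)
  proof induction
    case (rel u v)
    then show ?case by (rule rels)
  next
    case (cancel g e)
    show ?case using f[of g] by auto
  next
    case (congr u v p q)
    then show ?case by (simp add: word_value_append[OF assms(1,2)])
  qed auto
qed

lemma presented_group_universal:
  assumes "group H" "range f \<subseteq> carrier H"
    and rels: "\<And>u v. (u, v) \<in> Rels \<Longrightarrow> word_value H f u = word_value H f v"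
  obtains h where "h \<in> hom (presented_group Rels) H"
    and "\<And>u. h (word_class Rels u) = word_value H f u"
proof
  define h where "h A = word_value H f (SOME u. u \<in> A)" for A
  show h: "h (word_class Rels u) = word_value H f u" for u
  proof -
    have "(SOME v. v \<in> word_class Rels u) \<in> word_class Rels u"
      by (rule someI[of _ u]) (simp add: word_class_def word_eq.refl)
    then have "word_eq Rels u (SOME v. v \<in> word_class Rels u)"
      by (simp add: word_class_def)
    from word_value_cong[OF assms this] show ?thesis
      by (simp add: h_def)
  qed
  show "h \<in> hom (presented_group Rels) H"
    by (rule homI) (auto simp: carrier_presented_group h word_value_append[OF assms(1,2)]
        word_value_closed[OF assms(1,2)])
qed

lemma presented_group_hom_value:
  assumes "group H" "h \<in> hom (presented_group Rels) H"
  shows "h (word_class Rels u) = word_value H (\<lambda>g. h (word_class Rels [(g, True)])) u"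
proof -
  interpret P: group "presented_group Rels" by (rule group_presented_group)
  interpret group_hom "presented_group Rels" H h
    using assms by (simp add: group_hom_def group_hom_axioms_def P.is_group)
  have neg: "word_class Rels [(g, False)] = inv\<^bsub>presented_group Rels\<^esub> word_class Rels [(g, True)]"
    for g
    using word_eq.cancel[of Rels g False]
    by (intro P.inv_equality[symmetric]) (auto simp: word_class_eq_iff)
  show ?thesis
  proof (induction u)
    case Nil
    then show ?case using hom_one by simp
  next
    case (Cons x u)
    obtain g e where x: "x = (g, e)" by fastforce
    have "word_class Rels (x # u) =
        word_class Rels [x] \<otimes>\<^bsub>presented_group Rels\<^esub> word_class Rels u"
      by simp
    then have "h (word_class Rels (x # u)) = h (word_class Rels [x]) \<otimes>\<^bsub>H\<^esub> h (word_class Rels u)"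
      by (metis hom_mult word_class_in_carrier)
    then show ?case
      by (simp add: x Cons neg hom_inv)
  qed
qed

section \<open>Reversal systems\<close>

definition is_reversal :: "'a topology \<Rightarrow> ('a \<Rightarrow> 'a) \<Rightarrow> ('a \<Rightarrow> 'a) \<Rightarrow> bool" where
  "is_reversal X T R \<longleftrightarrow> homeomorphic_map X X R \<and>
    (\<forall>x\<in>topspace X. T (R x) = R (inv_into (topspace X) T x))"

definition reversal_system :: "'a topology \<Rightarrow> ('a \<Rightarrow> 'a) \<Rightarrow> ('a \<Rightarrow> 'a) \<Rightarrow> bool" where
  "reversal_system X T R \<longleftrightarrow> homeomorphic_map X X T \<and> is_reversal X T R"

definition has_order :: "'a topology \<Rightarrow> ('a \<Rightarrow> 'a) \<Rightarrow> nat \<Rightarrow> bool" where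
  "has_order X R n \<longleftrightarrow> n > 0 \<and> (\<forall>x\<in>topspace X. (R ^^ n) x = x) \<and>
    (\<forall>m. 0 < m \<and> m < n \<longrightarrow> \<not> (\<forall>x\<in>topspace X. (R ^^ m) x = x))"

datatype gen = Gen_a | Gen_b

text \<open>The relations \<open>a b = b a\<^sup>-\<^sup>1\<close> and \<open>b\<^sup>2\<^sup>r = 1\<close>.\<close>

definition reversal_rels :: "nat \<Rightarrow> (gen word \<times> gen word) set" where
  "reversal_rels r =
    {([(Gen_a, True), (Gen_b, True)], [(Gen_b, True), (Gen_a, False)]),
     (replicate (2 * r) (Gen_b, True), [])}"

definition reversal_group :: "nat \<Rightarrow> gen word set monoid" where
  "reversal_group r = presented_group (reversal_rels r)"

definition elt_a :: "nat \<Rightarrow> gen word set" where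
  "elt_a r = word_class (reversal_rels r) [(Gen_a, True)]"

definition elt_b :: "nat \<Rightarrow> gen word set" where
  "elt_b r = word_class (reversal_rels r) [(Gen_b, True)]"

text \<open>The action is determined on the carrier of \<open>reversal_group r\<close> by its values at \<open>a\<close> and \<open>b\<close>;
  existence and uniqueness are \<open>reversal_action_exists\<close> and \<open>reversal_action_unique\<close> below.\<close>

definition is_reversal_action ::
  "nat \<Rightarrow> 'a topology \<Rightarrow> ('a \<Rightarrow> 'a) \<Rightarrow> ('a \<Rightarrow> 'a) \<Rightarrow> (gen word set \<Rightarrow> 'a \<Rightarrow> 'a) \<Rightarrow> bool" where
  "is_reversal_action r X T R \<alpha> \<longleftrightarrow>
    group_action (reversal_group r) (topspace X) \<alpha> \<and>
    (\<forall>x\<in>topspace X. \<alpha> (elt_a r) x = T x \<and> \<alpha> (elt_b r) x = R x)"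

lemma BijGroup_mult_apply:
  assumes "f \<in> Bij S" "g \<in> Bij S" "x \<in> S"
  shows "(f \<otimes>\<^bsub>BijGroup S\<^esub> g) x = f (g x)"
  using assms by (simp add: BijGroup_def compose_def)

lemma reversal_action_exists:
  assumes sys: "reversal_system X T R" and per: "\<forall>x\<in>topspace X. (R ^^ (2 * r)) x = x"
  shows "\<exists>\<alpha>. is_reversal_action r X T R \<alpha>"
proof -
  let ?S = "topspace X"
  let ?B = "BijGroup ?S"
  let ?f = "case_gen (restrict T ?S) (restrict R ?S)"
  interpret B: group ?B by (rule group_BijGroup)
  have bij: "bij_betw T ?S ?S" "bij_betw R ?S ?S"
    using sys by (auto simp: reversal_system_def is_reversal_def bij_betw_def homeomorphic_map_def
        quotient_imp_surjective_map)
  then have TR: "restrict T ?S \<in> Bij ?S" "restrict R ?S \<in> Bij ?S"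
    by (auto simp: Bij_def cong: bij_betw_cong)
  have Rin: "R x \<in> ?S" if "x \<in> ?S" for x
    using bij(2) that by (auto simp: bij_betw_def)
  have carr: "carrier ?B = Bij ?S" by (simp add: BijGroup_def)
  have f: "range ?f \<subseteq> carrier ?B"
    using TR by (auto simp: carr split: gen.splits)
  have ext: "g = h" if "g \<in> Bij ?S" "h \<in> Bij ?S" "\<And>x. x \<in> ?S \<Longrightarrow> g x = h x" for g h
    using that by (meson Bij_imp_extensional extensionalityI)
  have invT: "inv\<^bsub>?B\<^esub> restrict T ?S = restrict (inv_into ?S (restrict T ?S)) ?S"
    by (rule B.inv_equality)
      (use TR in \<open>auto simp: carr restrict_inv_into_Bij BijGroup_def Bij_compose_restrict_eq\<close>)
  have inv_into_eq: "inv_into ?S (restrict T ?S) x = inv_into ?S T x" if "x \<in> ?S" for x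
    by (rule inv_into_f_eq) (use TR bij that in \<open>auto simp: bij_betw_def Bij_def f_inv_into_f inv_into_into\<close>)
  have invT_in: "inv_into ?S T x \<in> ?S" if "x \<in> ?S" for x
    using bij(1) that by (auto simp: bij_betw_def inv_into_into)
  have pow: "word_value ?B ?f (replicate n (Gen_b, True)) x = (R ^^ n) x"
    if "x \<in> ?S" for n x
    using that
  proof (induction n)
    case 0
    then show ?case by (simp add: BijGroup_def)
  next
    case (Suc n)
    have "(R ^^ n) x \<in> ?S" by (induction n) (use Suc.prems Rin in auto)
    with Suc show ?case
      using TR word_value_closed[OF group_BijGroup f]
      by (simp add: BijGroup_mult_apply carr)
  qed
  have rels: "word_value ?B ?f u = word_value ?B ?f v" if "(u, v) \<in> reversal_rels r" for u v
  proof (rule ext)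
    show "word_value ?B ?f u \<in> Bij ?S" "word_value ?B ?f v \<in> Bij ?S"
      using word_value_closed[OF group_BijGroup f] by (auto simp: carr)
    fix x assume x: "x \<in> ?S"
    consider "u = [(Gen_a, True), (Gen_b, True)]" "v = [(Gen_b, True), (Gen_a, False)]"
      | "u = replicate (2 * r) (Gen_b, True)" "v = []"
      using \<open>(u, v) \<in> reversal_rels r\<close> unfolding reversal_rels_def by blast
    then show "word_value ?B ?f u x = word_value ?B ?f v x"
    proof cases
      case 1
      have iB: "inv\<^bsub>?B\<^esub> restrict T ?S \<in> Bij ?S"
        using TR B.inv_closed by (simp add: carr)
      have "T (R x) = R (inv_into ?S T x)"
        using sys x by (simp add: reversal_system_def is_reversal_def)
      then show ?thesis
        using x TR iB 1 B.r_one[of "restrict R ?S"] B.r_one[of "inv\<^bsub>?B\<^esub> restrict T ?S"]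
        by (simp add: carr BijGroup_mult_apply Rin invT inv_into_eq invT_in)
    next
      case 2
      then show ?thesis
        using pow[OF x] per x by (simp add: BijGroup_def)
    qed
  qed
  obtain h where h: "h \<in> hom (presented_group (reversal_rels r)) ?B"
    and hv: "\<And>u. h (word_class (reversal_rels r) u) = word_value ?B ?f u"
    using presented_group_universal[OF group_BijGroup f rels] by blast
  have "group_action (reversal_group r) ?S h"
    unfolding group_action_def reversal_group_def group_hom_def group_hom_axioms_def
    using h by (simp add: group_presented_group group_BijGroup)
  moreover have "h (elt_a r) = restrict T ?S" "h (elt_b r) = restrict R ?S"
    using TR by (simp_all add: elt_a_def elt_b_def hv carr)
  ultimately show ?thesis
    by (auto simp: is_reversal_action_def)
qed

lemma reversal_action_unique:
  assumes "is_reversal_action r X T R \<alpha>" "is_reversal_action r X T R \<beta>"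
    and "g \<in> carrier (reversal_group r)"
  shows "\<alpha> g = \<beta> g"
proof -
  let ?c = "word_class (reversal_rels r)"
  let ?B = "BijGroup (topspace X)"
  have hom: "\<alpha> \<in> hom (presented_group (reversal_rels r)) ?B" "\<beta> \<in> hom (presented_group (reversal_rels r)) ?B"
    using assms by (auto simp: is_reversal_action_def group_action_def reversal_group_def
        group_hom_def group_hom_axioms_def)
  then have "\<alpha> (?c u) \<in> extensional (topspace X)" "\<beta> (?c u) \<in> extensional (topspace X)" for u
    by (auto simp: BijGroup_def Bij_def dest!: hom_in_carrier[of _ _ _ "?c u"])
  moreover have "\<alpha> (?c [(g, True)]) x = \<beta> (?c [(g, True)]) x" if "x \<in> topspace X" for g x
    using assms that by (cases g) (auto simp: is_reversal_action_def elt_a_def elt_b_def)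
  ultimately have "\<alpha> (?c [(g, True)]) = \<beta> (?c [(g, True)])" for g
    by (meson extensionalityI)
  then have "\<alpha> (?c u) = \<beta> (?c u)" for u
    using presented_group_hom_value[OF group_BijGroup hom(1), of u]
      presented_group_hom_value[OF group_BijGroup hom(2), of u] by presburger
  then show ?thesis
    using assms(3) by (auto simp: reversal_group_def carrier_presented_group)
qed

section \<open>Lind zeta function\<close>

text \<open>The index of a subgroup \<open>H\<close> is \<open>card (rcosets H)\<close>, provided that \<open>rcosets H\<close> is finite.\<close>

definition finite_index_subgroup :: "('g, 'm) monoid_scheme \<Rightarrow> 'g set \<Rightarrow> bool" where
  "finite_index_subgroup G H \<longleftrightarrow> subgroup H G \<and> finite (rcosets\<^bsub>G\<^esub> H)"

definition fixed_points :: "'a set \<Rightarrow> ('g \<Rightarrow> 'a \<Rightarrow> 'a) \<Rightarrow> 'g set \<Rightarrow> 'a set" where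
  "fixed_points E \<alpha> H = {x \<in> E. \<forall>h\<in>H. \<alpha> h x = x}"

text \<open>A formal sum over subgroups is taken coefficientwise: the coefficient of \<open>t\<^sup>n\<close> collects the
  subgroups of index \<open>n\<close>, of which there are only finitely many in a finitely generated group.
  The constant coefficient is \<open>0\<close>, since every finite index is positive.\<close>

definition lind_series :: "('g, 'm) monoid_scheme \<Rightarrow> 'a set \<Rightarrow> ('g \<Rightarrow> 'a \<Rightarrow> 'a) \<Rightarrow> real fps" where
  "lind_series G E \<alpha> = Abs_fps (\<lambda>n.
    \<Sum>H | finite_index_subgroup G H \<and> card (rcosets\<^bsub>G\<^esub> H) = n.
      real (card (fixed_points E \<alpha> H)) / real (card (rcosets\<^bsub>G\<^esub> H)))"

text \<open>The library's \<open>fps_exp 1\<close> is the series of \<open>exp t\<close>; substituting \<open>f\<close> for \<open>t\<close>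
  gives the formal exponential of \<open>f\<close>, meaningful when \<open>f\<close> has constant coefficient \<open>0\<close>. This holds for all
  series to which it is applied here.\<close>

definition formal_exp :: "real fps \<Rightarrow> real fps" where
  "formal_exp f = fps_exp 1 oo f"

definition lind_zeta :: "('g, 'm) monoid_scheme \<Rightarrow> 'a set \<Rightarrow> ('g \<Rightarrow> 'a \<Rightarrow> 'a) \<Rightarrow> real fps" where
  "lind_zeta G E \<alpha> = formal_exp (lind_series G E \<alpha>)"

section \<open>Generating functions\<close>

text \<open>\<open>subsystem X R n\<close> is the set \<open>X\<^sub>n\<close> of points \<open>x\<close> with \<open>R\<^sup>n x = x\<close>.\<close>

definition subsystem :: "'a topology \<Rightarrow> ('a \<Rightarrow> 'a) \<Rightarrow> nat \<Rightarrow> 'a set" where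
  "subsystem X R n = {x \<in> topspace X. (R ^^ n) x = x}"

text \<open>\<open>gen_fun_g k Y T R\<close> is the generating function of the system \<open>(Y, T, R)\<close> with \<open>R\<^sup>2\<^sup>k = id\<close>.\<close>

definition gen_fun_g :: "nat \<Rightarrow> 'a set \<Rightarrow> ('a \<Rightarrow> 'a) \<Rightarrow> ('a \<Rightarrow> 'a) \<Rightarrow> real fps" where
  "gen_fun_g k Y T R = Abs_fps (\<lambda>m. if m = 0 then 0 else
    \<Sum>l<k. real (card {x \<in> Y. (T ^^ m) ((R ^^ (2 * l)) x) = x}) / real m)"

text \<open>The second argument of \<open>flip_count\<close> only takes the values \<open>0\<close> and \<open>1\<close> in the generating
  function, so negative powers of \<open>T\<close> do not occur.\<close>

definition flip_count :: "'a set \<Rightarrow> ('a \<Rightarrow> 'a) \<Rightarrow> ('a \<Rightarrow> 'a) \<Rightarrow> nat \<Rightarrow> nat \<Rightarrow> nat" where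
  "flip_count Y T F m n = card {x \<in> Y. (T ^^ m) x = x \<and> (T ^^ n) (F x) = x}"

definition gen_fun_h :: "'a set \<Rightarrow> ('a \<Rightarrow> 'a) \<Rightarrow> ('a \<Rightarrow> 'a) \<Rightarrow> real fps" where
  "gen_fun_h Y T F = Abs_fps (\<lambda>m. if m = 0 then 0
    else if odd m then real (flip_count Y T F m 0)
    else (real (flip_count Y T F m 0) + real (flip_count Y T F m 1)) / 2)"

end

theory Submission
  imports
    Defs
    "HOL-Algebra.Generated_Groups"
    "HOL-Computational_Algebra.Formal_Laurent_Series"
begin

text \<open>Every element of \<open>G\<^sub>2\<^sub>r\<close> is uniquely \<open>a\<^sup>i b\<^sup>j\<close> with \<open>j\<close> modulo \<open>2r\<close>. A finite-index subgroup that only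
  involves even powers of \<open>b\<close> lies in an abelian group and is generated by \<open>b\<^sup>2\<^sup>k\<close> and \<open>a\<^sup>m b\<^sup>2\<^sup>l\<close> with \<open>k dvd r\<close> and
  \<open>l < k\<close>; its index is \<open>2km\<close> and its fixed points are counted by \<open>g\<^sub>2\<^sub>k\<close>. Any other one is
  generated by \<open>a\<^sup>m\<close> and \<open>a\<^sup>i b\<^sup>j\<close> with \<open>j\<close> an odd divisor of \<open>r\<close> and \<open>i < m\<close>; its index is \<open>jm\<close>, and the number
  of its fixed points depends only on \<open>i\<close> modulo 2 because conjugation by \<open>a\<close> replaces \<open>i\<close> by \<open>i + 2\<close>.
  Comparing coefficients gives the logarithm of the formula.\<close>

section \<open>Formal exponentials\<close>

text \<open>Coefficient \<open>m\<close> of \<open>h * f\<close> involves \<open>f\<close> only up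
  to coefficient \<open>m\<close>, so the equation determines coefficient \<open>m + 1\<close> from
  earlier ones.\<close>

lemma fps_linear_ode_unique:
  fixes f g h :: "real fps"
  assumes "fps_deriv f = h * f" "fps_deriv g = h * g" "f $ 0 = g $ 0"
  shows "f = g"
proof (rule fps_ext)
  fix n
  show "f $ n = g $ n"
  proof (induction n rule: less_induct)
    case (less n)
    show ?case
    proof (cases n)
      case 0
      then show ?thesis using assms by simp
    next
      case (Suc m)
      have "(h * f) $ m = (h * g) $ m"
        unfolding fps_mult_nth by (rule sum.cong) (use less Suc in auto)
      then have "fps_deriv f $ m = fps_deriv g $ m"
        using assms by simp
      then show ?thesis using Suc by simp
    qed
  qed
qed

lemma formal_exp_nth_0 [simp]: "formal_exp f $ 0 = 1"
  by (simp add: formal_exp_def)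

lemma formal_exp_0 [simp]: "formal_exp 0 = 1"
  by (simp add: formal_exp_def fps_compose_0_right)

lemma fps_deriv_formal_exp:
  assumes "f $ 0 = 0"
  shows "fps_deriv (formal_exp f) = fps_deriv f * formal_exp f"
  using fps_compose_deriv[OF assms, of "fps_exp 1"] by (simp add: formal_exp_def mult.commute)

text \<open>Both sides solve \<open>y' = (f' + g') * y\<close> with constant coefficient 1, which
  avoids any computation with the coefficients of the compositions.\<close>

lemma formal_exp_add:
  assumes "f $ 0 = 0" "g $ 0 = 0"
  shows "formal_exp (f + g) = formal_exp f * formal_exp g"
  by (rule fps_linear_ode_unique[where h = "fps_deriv f + fps_deriv g"])
    (use assms in \<open>simp_all add: fps_deriv_formal_exp algebra_simps\<close>)

lemma formal_exp_sum:
  assumes "\<And>i. i \<in> I \<Longrightarrow> f i $ 0 = 0"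
  shows "formal_exp (\<Sum>i\<in>I. f i) = (\<Prod>i\<in>I. formal_exp (f i))"
  using assms
proof (induction I rule: infinite_finite_induct)
  case (insert i I)
  then show ?case by (simp add: formal_exp_add fps_sum_nth)
qed simp_all

section \<open>Transversals and subgroups of the integers\<close>

text \<open>Two right cosets \<open>H #> g\<close> and \<open>H #> g'\<close> agree iff
  \<open>g \<otimes> inv g'\<close> lies in \<open>H\<close>, so \<open>ex\<close> and
  \<open>inj\<close> say that each coset is hit exactly once. Indices are later read off from
  explicit transversals.\<close>

lemma (in group) bij_betw_rcosets_transversal:
  assumes H: "subgroup H G"
    and t: "\<And>i. i \<in> I \<Longrightarrow> t i \<in> carrier G"
    and ex: "\<And>g. g \<in> carrier G \<Longrightarrow> \<exists>i\<in>I. g \<otimes> inv (t i) \<in> H"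
    and inj: "\<And>i i'. i \<in> I \<Longrightarrow> i' \<in> I \<Longrightarrow> t i \<otimes> inv (t i') \<in> H \<Longrightarrow> i = i'"
  shows "bij_betw (\<lambda>i. H #> t i) I (rcosets H)"
proof -
  have eq: "H #> g = H #> g' \<longleftrightarrow> g \<otimes> inv g' \<in> H"
    if "g \<in> carrier G" "g' \<in> carrier G" for g g'
    by (metis H is_group repr_independence subgroup.rcos_module rcos_self that)
  show ?thesis
    unfolding bij_betw_def
  proof (intro conjI inj_onI)
    fix i i' assume "i \<in> I" "i' \<in> I" "H #> t i = H #> t i'"
    then show "i = i'" using eq t inj by blast
  next
    show "(\<lambda>i. H #> t i) ` I = rcosets H"
    proof (intro equalityI subsetI)
      fix C assume "C \<in> (\<lambda>i. H #> t i) ` I"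
      then show "C \<in> rcosets H" unfolding RCOSETS_def using t by blast
    next
      fix C assume "C \<in> rcosets H"
      then obtain g where g: "g \<in> carrier G" "C = H #> g" unfolding RCOSETS_def by blast
      then obtain i where "i \<in> I" "g \<otimes> inv (t i) \<in> H" using ex by blast
      then show "C \<in> (\<lambda>i. H #> t i) ` I" using eq g t by blast
    qed
  qed
qed

text \<open>The generator is the least positive element; the remainder of any element modulo it lies
  in \<open>D\<close> and is smaller, hence 0. Closure under differences already yields negatives,
  sums and multiples.\<close>

lemma int_subgroup_cyclic:
  fixes D :: "int set"
  assumes diff: "\<And>x y. x \<in> D \<Longrightarrow> y \<in> D \<Longrightarrow> x - y \<in> D" and pos: "c \<in> D" "c > 0"
  obtains d where "d > 0" "\<And>x. x \<in> D \<longleftrightarrow> d dvd x"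
proof -
  define d where "d = (LEAST n. 0 < n \<and> int n \<in> D)"
  have "0 < nat c \<and> int (nat c) \<in> D" using pos by simp
  then have d: "0 < d \<and> int d \<in> D" unfolding d_def by (rule LeastI)
  have d_le: "d \<le> n" if "0 < n" "int n \<in> D" for n
    unfolding d_def using that by (intro Least_le) simp
  have zero: "0 \<in> D" using diff[OF pos(1) pos(1)] by simp
  have neg: "- x \<in> D" if "x \<in> D" for x using diff[OF zero that] by simp
  have add: "x + y \<in> D" if "x \<in> D" "y \<in> D" for x y using diff[OF that(1) neg[OF that(2)]] by simp
  have nmul: "int n * x \<in> D" if "x \<in> D" for n x
    by (induction n) (use zero add that in \<open>auto simp: algebra_simps\<close>)
  have mul: "k * x \<in> D" if "x \<in> D" for k x
  proof (cases "k \<ge> 0")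
    case True
    then show ?thesis using nmul[OF that, of "nat k"] by simp
  next
    case False
    then show ?thesis using neg[OF nmul[OF that, of "nat (- k)"]] by simp
  qed
  show thesis
  proof
    show "0 < int d" using d by simp
    fix x
    show "x \<in> D \<longleftrightarrow> int d dvd x"
    proof
      assume x: "x \<in> D"
      have "x mod int d = x - (x div int d) * int d" by (simp add: minus_div_mult_eq_mod)
      then have "x mod int d \<in> D" using diff[OF x mul[of "int d"]] d by simp
      moreover have "0 \<le> x mod int d" "x mod int d < int d" using d by simp_all
      ultimately have "x mod int d = 0"
        using d_le[of "nat (x mod int d)"] by (cases "x mod int d = 0") auto
      then show "int d dvd x" by presburger
    next
      assume "int d dvd x"
      then show "x \<in> D" using mul[of "int d" "x div int d"] d by simp
    qed
  qed
qed

section \<open>The twisted product of two infinite cyclic groups\<close>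

text \<open>The pair \<open>(i, j)\<close> stands for \<open>a\<^sup>i b\<^sup>j\<close> in the group \<open>\<langle>a, b | ab = ba\<^sup>-\<^sup>1\<rangle>\<close>.\<close>

definition twist :: "(int \<times> int) monoid" where
  "twist = \<lparr>carrier = UNIV,
    monoid.mult = (\<lambda>p q. (fst p + (if even (snd p) then fst q else - fst q), snd p + snd q)),
    one = (0, 0)\<rparr>"

lemma carrier_twist [simp]: "carrier twist = UNIV"
  and one_twist [simp]: "\<one>\<^bsub>twist\<^esub> = (0, 0)"
  and mult_twist [simp]:
    "(i, j) \<otimes>\<^bsub>twist\<^esub> (i', j') = (i + (if even j then i' else - i'), j + j')"
  by (simp_all add: twist_def)

lemma group_twist: "group twist"
proof (rule groupI)
  fix p assume "p \<in> carrier twist"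
  have "(if even (snd p) then - fst p else fst p, - snd p) \<otimes>\<^bsub>twist\<^esub> p = \<one>\<^bsub>twist\<^esub>"
    by (cases p) simp
  then show "\<exists>q\<in>carrier twist. q \<otimes>\<^bsub>twist\<^esub> p = \<one>\<^bsub>twist\<^esub>" by auto
qed auto

interpretation twist: group twist
  by (rule group_twist)

lemma inv_twist [simp]: "inv\<^bsub>twist\<^esub> (i, j) = (if even j then - i else i, - j)"
  by (rule twist.inv_equality) auto

lemma subgroup_twistI:
  assumes "p \<in> S" "\<And>p q. p \<in> S \<Longrightarrow> q \<in> S \<Longrightarrow> p \<otimes>\<^bsub>twist\<^esub> inv\<^bsub>twist\<^esub> q \<in> S"
  shows "subgroup S twist"
proof -
  have one: "\<one>\<^bsub>twist\<^esub> \<in> S" using assms(2)[OF assms(1) assms(1)] by (metis twist.r_inv UNIV_I carrier_twist)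
  have inv: "inv\<^bsub>twist\<^esub> q \<in> S" if "q \<in> S" for q
    using assms(2)[OF one that] by (metis twist.l_one UNIV_I carrier_twist)
  show ?thesis
  proof (rule twist.subgroupI)
    fix p q assume "p \<in> S" "q \<in> S"
    from assms(2)[OF this(1) inv[OF this(2)]] show "p \<otimes>\<^bsub>twist\<^esub> q \<in> S" by simp
  qed (use assms(1) inv in auto)
qed

text \<open>Right multiplication by \<open>p\<close> is invertible, so the recursion determines
  \<open>f\<close> in both directions from \<open>f 0\<close>. A guessed closed form for powers is
  thereby reduced to two simple checks.\<close>

lemma twist_int_pow:
  assumes "f 0 = (0, 0)" "\<And>u. f (u + 1) = f u \<otimes>\<^bsub>twist\<^esub> p"
  shows "p [^]\<^bsub>twist\<^esub> (u :: int) = f u"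
proof (induction u rule: int_induct[of _ 0])
  case base
  then show ?case using assms by simp
next
  case (step1 u)
  then show ?case using assms twist.int_pow_mult[of p u 1] by simp
next
  case (step2 u)
  have "f u = f (u - 1) \<otimes>\<^bsub>twist\<^esub> p" using assms(2)[of "u - 1"] by simp
  then have "f (u - 1) = f u \<otimes>\<^bsub>twist\<^esub> inv\<^bsub>twist\<^esub> p" by (simp add: twist.m_assoc)
  then show ?case using step2 twist.int_pow_diff[of p u 1] by simp
qed

section \<open>The two families of subgroups of the twisted product\<close>

text \<open>The products of the \<open>u\<close>-th power of \<open>(m, 2 * l)\<close> and the
  \<open>v\<close>-th power of \<open>(0, 2 * k)\<close>. These two generators commute since their
  second coordinates are even.\<close>

definition even_type :: "int \<Rightarrow> int \<Rightarrow> int \<Rightarrow> (int \<times> int) set" where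
  "even_type k m l = {(m * u, 2 * l * u + 2 * k * v) | u v. True}"

text \<open>For odd \<open>j\<close>, the products of the \<open>u\<close>-th power of
  \<open>(m, 0)\<close> and the \<open>v\<close>-th power of \<open>(i, j)\<close>. The square of
  \<open>(i, j)\<close> is \<open>(0, 2 * j)\<close>, so \<open>i\<close> enters only through the
  parity of \<open>v\<close>.\<close>

definition odd_type :: "int \<Rightarrow> int \<Rightarrow> int \<Rightarrow> (int \<times> int) set" where
  "odd_type j m i = {(m * u + (if even v then 0 else i), j * v) | u v. True}"

lemma even_type_iff: "(x, y) \<in> even_type k m l \<longleftrightarrow> (\<exists>u v. x = m * u \<and> y = 2 * l * u + 2 * k * v)"
  by (auto simp: even_type_def)

lemma odd_type_iff:
  "(x, y) \<in> odd_type j m i \<longleftrightarrow> (\<exists>u v. x = m * u + (if even v then 0 else i) \<and> y = j * v)"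
  by (auto simp: odd_type_def)

lemma subgroup_even_type: "subgroup (even_type k m l) twist"
proof (rule subgroup_twistI)
  show "(m * 0, 2 * l * 0 + 2 * k * 0) \<in> even_type k m l" unfolding even_type_def by blast
  fix p q assume "p \<in> even_type k m l" "q \<in> even_type k m l"
  then obtain u v u' v' where "p = (m * u, 2 * l * u + 2 * k * v)" "q = (m * u', 2 * l * u' + 2 * k * v')"
    unfolding even_type_def by blast
  then have "p \<otimes>\<^bsub>twist\<^esub> inv\<^bsub>twist\<^esub> q = (m * (u - u'), 2 * l * (u - u') + 2 * k * (v - v'))"
    by (simp add: algebra_simps)
  then show "p \<otimes>\<^bsub>twist\<^esub> inv\<^bsub>twist\<^esub> q \<in> even_type k m l" unfolding even_type_def by blast
qed

lemma subgroup_odd_type: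
  assumes "odd j"
  shows "subgroup (odd_type j m i) twist"
proof (rule subgroup_twistI)
  show "(m * 0 + (if even (0::int) then 0 else i), j * 0) \<in> odd_type j m i"
    unfolding odd_type_def by blast
  fix p q assume "p \<in> odd_type j m i" "q \<in> odd_type j m i"
  then obtain u v u' v' where "p = (m * u + (if even v then 0 else i), j * v)"
    "q = (m * u' + (if even v' then 0 else i), j * v')"
    unfolding odd_type_def by blast
  \<comment> \<open>If \<open>v\<close> and \<open>v'\<close> have equal parity, the two
    contributions of \<open>i\<close> cancel and \<open>u'\<close> is subtracted; otherwise exactly
    one \<open>i\<close> survives and \<open>u'\<close> is added.\<close>
  then have "p \<otimes>\<^bsub>twist\<^esub> inv\<^bsub>twist\<^esub> q =
      (m * (if even (v - v') then u - u' else u + u') +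
        (if even (v - v') then 0 else i), j * (v - v'))"
    using assms by (cases "even v"; cases "even v'") (simp_all add: algebra_simps)
  then show "p \<otimes>\<^bsub>twist\<^esub> inv\<^bsub>twist\<^esub> q \<in> odd_type j m i" unfolding odd_type_def by blast
qed

text \<open>Together with \<open>subgroup_even_type\<close> this makes
  \<open>even_type k m l\<close> the subgroup generated by the two pairs. It serves both for the
  classification and, applied to stabilizers, for counting fixed points.\<close>

lemma even_type_subset:
  assumes S: "subgroup S twist" and "(m, 2 * l) \<in> S" "(0, 2 * k) \<in> S"
  shows "even_type k m l \<subseteq> S"
proof
  fix p assume "p \<in> even_type k m l"
  then obtain u v where p: "p = (m * u, 2 * l * u + 2 * k * v)" unfolding even_type_def by blast
  have "(m, 2 * l) [^]\<^bsub>twist\<^esub> u = (m * u, 2 * l * u)" "(0, 2 * k) [^]\<^bsub>twist\<^esub> v = (0, 2 * k * v)"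
    by (rule twist_int_pow; simp add: algebra_simps)+
  then have "p = (m, 2 * l) [^]\<^bsub>twist\<^esub> u \<otimes>\<^bsub>twist\<^esub> (0, 2 * k) [^]\<^bsub>twist\<^esub> v" by (simp add: p)
  then show "p \<in> S"
    using assms by (simp add: subgroup.m_closed[OF S] twist.subgroup_int_pow_closed[OF S])
qed

lemma odd_type_subset:
  assumes S: "subgroup S twist" and "odd j" and "(m, 0) \<in> S" "(i, j) \<in> S"
  shows "odd_type j m i \<subseteq> S"
proof
  fix p assume "p \<in> odd_type j m i"
  then obtain u v where p: "p = (m * u + (if even v then 0 else i), j * v)" unfolding odd_type_def by blast
  have "(m, 0) [^]\<^bsub>twist\<^esub> u = (m * u, 0)" by (rule twist_int_pow; simp add: algebra_simps)
  moreover have "(i, j) [^]\<^bsub>twist\<^esub> v = (if even v then 0 else i, j * v)"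
    by (rule twist_int_pow) (use \<open>odd j\<close> in \<open>auto simp: algebra_simps\<close>)
  ultimately have "p = (m, 0) [^]\<^bsub>twist\<^esub> u \<otimes>\<^bsub>twist\<^esub> (i, j) [^]\<^bsub>twist\<^esub> v" by (simp add: p)
  then show "p \<in> S"
    using assms by (simp add: subgroup.m_closed[OF S] twist.subgroup_int_pow_closed[OF S])
qed

text \<open>If all second coordinates are even, project to the first coordinate; otherwise project to the second one.\<close>

lemma twist_subgroup_cases:
  assumes S: "subgroup S twist" and c: "(c, 0) \<in> S" "c > 0" and r: "(0, 2 * r) \<in> S" "r > 0"
  obtains (even) k m l where "S = even_type k m l" "k > 0" "k dvd r" "m > 0" "0 \<le> l" "l < k"
    | (odd) j m i where "S = odd_type j m i" "j > 0" "odd j" "j dvd r" "m > 0" "0 \<le> i" "i < m"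
proof (cases "\<forall>p\<in>S. even (snd p)")
  case True
  \<comment> \<open>With only even second coordinates the twist is invisible, so quotients in
    \<open>S\<close> are componentwise differences.\<close>
  have sub: "(x - x', y - y') \<in> S" if "(x, y) \<in> S" "(x', y') \<in> S" for x y x' y'
  proof -
    have "(x, y) \<otimes>\<^bsub>twist\<^esub> inv\<^bsub>twist\<^esub> (x', y') \<in> S"
      using that S by (simp only: subgroup.m_closed subgroup.m_inv_closed)
    moreover have "even y" "even y'" using True that by force+
    ultimately show ?thesis by simp
  qed
  obtain m where m: "m > 0" "\<And>x. x \<in> fst ` S \<longleftrightarrow> m dvd x"
  proof (rule int_subgroup_cyclic[of "fst ` S" c])
    show "x - y \<in> fst ` S" if "x \<in> fst ` S" "y \<in> fst ` S" for x y
      using that sub by force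
  qed (use c in force)+
  \<comment> \<open>\<open>k2\<close> generates the intersection of \<open>S\<close> with the axis
    of powers of \<open>b\<close>; it is nonzero because \<open>(0, 2 * r)\<close> lies
    there.\<close>
  obtain k2 where k2: "k2 > 0" "\<And>y. y \<in> {y. (0, y) \<in> S} \<longleftrightarrow> k2 dvd y"
    by (rule int_subgroup_cyclic[of "{y. (0, y) \<in> S}" "2 * r"])
      (use r sub[of 0 _ 0] in auto)
  have "(0, k2) \<in> S" using k2(2)[of k2] by simp
  then have "even k2" using True by force
  then obtain k where k: "k2 = 2 * k" by blast
  obtain y0 where y0: "(m, y0) \<in> S" using m(2)[of m] by force
  \<comment> \<open>Any element of \<open>S\<close> above \<open>m\<close> may be altered by powers
    of \<open>(0, 2 * k)\<close>, so half its second coordinate can be reduced modulo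
    \<open>k\<close>.\<close>
  define l where "l = (y0 div 2) mod k"
  have y0': "y0 = 2 * (y0 div 2)" using True y0 by force
  have kpos: "k > 0" using k k2 by simp
  have "(0, 2 * k * ((y0 div 2) div k)) \<in> S" using k2(2)[of "2 * k * ((y0 div 2) div k)"] k by simp
  from sub[OF y0 this] have "(m, y0 - 2 * k * ((y0 div 2) div k)) \<in> S" by simp
  moreover have "y0 - 2 * k * ((y0 div 2) div k) = 2 * l"
    unfolding l_def minus_mult_div_eq_mod[symmetric] using y0' by (simp add: algebra_simps)
  ultimately have ml: "(m, 2 * l) \<in> S" by simp
  have "S \<subseteq> even_type k m l"
  proof
    fix p assume "p \<in> S"
    then obtain x y where p: "p = (x, y)" "(x, y) \<in> S" by (cases p) auto
    then have "m dvd x" using m(2) by force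
    then obtain u where u: "x = m * u" by blast
    \<comment> \<open>The \<open>u\<close>-th power of \<open>(m, 2 * l)\<close> has the same first
      coordinate as \<open>p\<close>, so the difference lies on the axis generated by
      \<open>(0, k2)\<close>.\<close>
    have "(m * u, 2 * l * u + 2 * k * 0) \<in> S"
      using even_type_subset[OF S ml, of k] \<open>(0, k2) \<in> S\<close> k even_type_iff by blast
    from sub[OF p(2) this] have "k2 dvd y - 2 * l * u" using k2(2) u by simp
    then obtain v where "y - 2 * l * u = k2 * v" by blast
    then show "p \<in> even_type k m l" using p u k by (auto simp: even_type_iff algebra_simps)
  qed
  moreover have "even_type k m l \<subseteq> S"
    using even_type_subset[OF S ml] \<open>(0, k2) \<in> S\<close> k by simp
  moreover have "k dvd r" using k2(2)[of "2 * r"] r k by simp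
  moreover have "0 \<le> l" "l < k" using kpos by (simp_all add: l_def)
  ultimately show thesis using even[of k m l] kpos m(1) by blast
next
  case False
  then obtain x1 y1 where xy1: "(x1, y1) \<in> S" "odd y1" by force
  have sub: "(x - (if even (y - y') then x' else - x'), y - y') \<in> S"
    if "(x, y) \<in> S" "(x', y') \<in> S" for x y x' y'
  proof -
    have "(x, y) \<otimes>\<^bsub>twist\<^esub> inv\<^bsub>twist\<^esub> (x', y') \<in> S"
      using that S by (simp only: subgroup.m_closed subgroup.m_inv_closed)
    then show ?thesis by (auto split: if_splits)
  qed
  \<comment> \<open>The second coordinate is additive even in the twisted product, so it can be
    projected; the first coordinate is then controlled by the intersection with the axis of powers
    of \<open>a\<close>.\<close>
  obtain j where j: "j > 0" "\<And>y. y \<in> snd ` S \<longleftrightarrow> j dvd y"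
  proof (rule int_subgroup_cyclic[of "snd ` S" "2 * r"])
    show "x - y \<in> snd ` S" if "x \<in> snd ` S" "y \<in> snd ` S" for x y
      using that sub by force
  qed (use r in force)+
  have "j dvd y1" using j(2) xy1 by force
  then have "odd j" using xy1 by auto
  have "j dvd 2 * r" using j(2) r by force
  then have "j dvd r" using \<open>odd j\<close> by (simp add: coprime_dvd_mult_right_iff)
  obtain m where m: "m > 0" "\<And>x. x \<in> {x. (x, 0) \<in> S} \<longleftrightarrow> m dvd x"
    by (rule int_subgroup_cyclic[of "{x. (x, 0) \<in> S}" c])
      (use c sub[of _ 0 _ 0] in auto)
  have mS: "(m, 0) \<in> S" using m(2)[of m] by simp
  obtain x0 where x0: "(x0, j) \<in> S" using j(2)[of j] by force
  \<comment> \<open>Left division by this element reduces the first coordinate of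
    \<open>(x0, j)\<close> modulo \<open>m\<close>, which gives the parameter
    \<open>i\<close>.\<close>
  have "(m * (x0 div m), 0) \<in> S" using m(2)[of "m * (x0 div m)"] by simp
  from subgroup.m_closed[OF S subgroup.m_inv_closed[OF S this] x0]
  have "(x0 - m * (x0 div m), j) \<in> S" by simp
  then have i: "(x0 mod m, j) \<in> S" by (simp add: minus_mult_div_eq_mod)
  have "S \<subseteq> odd_type j m (x0 mod m)"
  proof
    fix p assume "p \<in> S"
    then obtain x y where p: "p = (x, y)" "(x, y) \<in> S" by (cases p) auto
    then have "j dvd y" using j(2) by force
    then obtain v where v: "y = j * v" by blast
    have "(m * 0 + (if even v then 0 else x0 mod m), j * v) \<in> S"
      using odd_type_subset[OF S \<open>odd j\<close> mS i] odd_type_iff by blast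
    from sub[OF p(2) this] have "m dvd x - (if even v then 0 else x0 mod m)"
      using m(2) v by (auto split: if_splits)
    then obtain u where "x - (if even v then 0 else x0 mod m) = m * u" by blast
    then show "p \<in> odd_type j m (x0 mod m)" using p v
      unfolding p odd_type_iff by (intro exI[of _ u] exI[of _ v]) simp
  qed
  moreover have "odd_type j m (x0 mod m) \<subseteq> S"
    by (rule odd_type_subset[OF S \<open>odd j\<close> mS i])
  ultimately show thesis
    using odd[of j m "x0 mod m"] j m(1) \<open>odd j\<close> \<open>j dvd r\<close> by simp
qed

section \<open>Uniqueness of the parameters\<close>

text \<open>The parameters are read off from the subgroup: \<open>k\<close> generates the
  \<open>y\<close> with \<open>(0, 2 * y)\<close> in it, \<open>m\<close> generates the first
  projection, and the elements above \<open>m\<close> determine \<open>l\<close> modulo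
  \<open>k\<close>.\<close>

lemma even_type_eq_iff:
  assumes "k > 0" "m > 0" "0 \<le> l" "l < k" "k' > 0" "m' > 0" "0 \<le> l'" "l' < k'"
  shows "even_type k m l = even_type k' m' l' \<longleftrightarrow> k = k' \<and> m = m' \<and> l = l'"
proof
  assume eq: "even_type k m l = even_type k' m' l'"
  have gens: "(0, 2 * k) \<in> even_type k m l" "(m, 2 * l) \<in> even_type k m l" for k m l
    unfolding even_type_iff by (rule exI[of _ 0], rule exI[of _ 1], simp)
      (rule exI[of _ 1], rule exI[of _ 0], simp)
  have proj: "k dvd y" if "(0, 2 * y) \<in> even_type k m l" "m > 0" for k m l y
    using that by (auto simp: even_type_iff)
  have proj': "m dvd x" if "(x, y) \<in> even_type k m l" for k m l x y
    using that by (auto simp: even_type_iff)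
  have "k dvd k'" "k' dvd k"
    using proj[of k' k m l] proj[of k k' m' l'] gens(1) eq assms by auto
  moreover have "m dvd m'" "m' dvd m"
    using proj'[of m' "2 * l'" k m l] proj'[of m "2 * l" k' m' l'] gens(2) eq by auto
  ultimately have km: "k = k'" "m = m'" using assms zdvd_antisym_nonneg by simp_all
  then have "(m, 2 * l) \<in> even_type k m l'" using eq gens(2)[of m l k] by simp
  then obtain v where "2 * l = 2 * l' + 2 * k * v" using assms by (auto simp: even_type_iff)
  then have "l - l' = k * v" by (simp add: algebra_simps)
  then have "k dvd l - l'" by simp
  then show "k = k' \<and> m = m' \<and> l = l'"
    using km assms by (metis mod_pos_pos_trivial mod_eq_dvd_iff)
qed simp

text \<open>Here \<open>j\<close> generates the second projection, \<open>m\<close> the intersection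
  with the first axis, and the elements with second coordinate \<open>j\<close> determine
  \<open>i\<close> modulo \<open>m\<close>.\<close>

lemma odd_type_eq_iff:
  assumes "j > 0" "m > 0" "0 \<le> i" "i < m" "j' > 0" "m' > 0" "0 \<le> i'" "i' < m'"
  shows "odd_type j m i = odd_type j' m' i' \<longleftrightarrow> j = j' \<and> m = m' \<and> i = i'"
proof
  assume eq: "odd_type j m i = odd_type j' m' i'"
  have gens: "(m, 0) \<in> odd_type j m i" "(i, j) \<in> odd_type j m i" for j m i
    unfolding odd_type_iff by (rule exI[of _ 1], rule exI[of _ 0], simp)
      (rule exI[of _ 0], rule exI[of _ 1], simp)
  have proj: "m dvd x" if "(x, 0) \<in> odd_type j m i" "j > 0" for j m i x
    using that by (auto simp: odd_type_iff)
  have proj': "j dvd y" if "(x, y) \<in> odd_type j m i" for j m i x y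
    using that by (auto simp: odd_type_iff)
  have "m dvd m'" "m' dvd m"
    using proj[of m' j m i] proj[of m j' m' i'] gens(1) eq assms by auto
  moreover have "j dvd j'" "j' dvd j"
    using proj'[of i' j' j m i] proj'[of i j j' m' i'] gens(2) eq by auto
  ultimately have jm: "j = j'" "m = m'" using assms zdvd_antisym_nonneg by simp_all
  then have "(i, j) \<in> odd_type j m i'" using eq gens(2)[of i j m] by simp
  then have "m dvd i - i'" using assms by (auto simp: odd_type_iff)
  then show "j = j' \<and> m = m' \<and> i = i'"
    using jm assms by (metis mod_pos_pos_trivial mod_eq_dvd_iff)
qed simp

lemma even_type_neq_odd_type:
  assumes "odd j"
  shows "even_type k m l \<noteq> odd_type j m' i"
proof -
  have "(i, j) \<in> odd_type j m' i"
    unfolding odd_type_iff by (rule exI[of _ 0], rule exI[of _ 1], simp)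
  moreover have "(i, j) \<notin> even_type k m l" using assms by (auto simp: even_type_iff)
  ultimately show ?thesis by metis
qed

section \<open>Normal forms in the reversal group\<close>

text \<open>Moving one \<open>b\<close> or \<open>inv b\<close> past a power of \<open>a\<close>
  inverts that power, so only the parity of \<open>j\<close> matters. In the induction on
  \<open>j\<close> the exponent \<open>i\<close> stays arbitrary because its sign changes at each
  step.\<close>

lemma (in group) twisted_commutation:
  assumes a: "a \<in> carrier G" and b: "b \<in> carrier G" and ab: "a \<otimes> b = b \<otimes> inv a"
  shows "b [^] (j :: int) \<otimes> a [^] (i :: int) = a [^] (if even j then i else - i) \<otimes> b [^] j"
proof -
  have ba: "b \<otimes> a = inv a \<otimes> b"
  proof -
    have "a \<otimes> (b \<otimes> a) = b \<otimes> inv a \<otimes> a" using a b by (simp add: m_assoc flip: ab)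
    also have "\<dots> = b" using a b by (simp add: m_assoc)
    finally have "a \<otimes> (b \<otimes> a) = b" .
    then show ?thesis using a b by (metis inv_solve_left m_closed)
  qed
  have one: "b \<otimes> a [^] i = a [^] (- i) \<otimes> b" for i :: int
  proof (induction i rule: int_induct[of _ 0])
    case base
    then show ?case using b by simp
  next
    case (step1 i)
    have "b \<otimes> a [^] (i + 1) = (b \<otimes> a [^] i) \<otimes> a" using a b by (simp add: int_pow_mult m_assoc)
    also have "\<dots> = a [^] (- i) \<otimes> (inv a \<otimes> b)" using a b step1 by (simp add: m_assoc ba)
    also have "\<dots> = a [^] (- i - 1) \<otimes> b" using a b by (simp add: int_pow_diff m_assoc)
    finally show ?case by simp
  next
    case (step2 i)
    have "b \<otimes> a [^] (i - 1) = (b \<otimes> a [^] i) \<otimes> inv a" using a b by (simp add: int_pow_diff m_assoc)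
    also have "\<dots> = a [^] (- i) \<otimes> (a \<otimes> b)" using a b step2 by (simp add: m_assoc ab)
    also have "\<dots> = a [^] (- i + 1) \<otimes> b" using a b int_pow_mult[OF a, of "- i" 1] by (simp add: m_assoc)
    finally show ?case by simp
  qed
  have one': "inv b \<otimes> a [^] i = a [^] (- i) \<otimes> inv b" for i :: int
  proof -
    have "b \<otimes> (a [^] (- i) \<otimes> inv b) = a [^] i"
      using a b one[of "- i"] by (simp add: m_assoc[symmetric]) (simp add: m_assoc)
    then show ?thesis using a b by (metis inv_solve_left inv_closed int_pow_closed m_closed)
  qed
  show ?thesis
  proof (induction j arbitrary: i rule: int_induct[of _ 0])
    case base
    then show ?case using a by simp
  next
    case (step1 j)
    have "b [^] (j + 1) \<otimes> a [^] i = b [^] j \<otimes> a [^] (- i) \<otimes> b"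
      using a b one by (simp add: int_pow_mult m_assoc)
    also have "\<dots> = a [^] (if even j then - i else i) \<otimes> b [^] (j + 1)"
      using a b step1(2)[of "- i"] by (simp add: int_pow_mult m_assoc)
    finally show ?case by (simp add: if_distrib)
  next
    case (step2 j)
    have "b [^] (j - 1) \<otimes> a [^] i = b [^] j \<otimes> a [^] (- i) \<otimes> inv b"
      using a b one' by (simp add: int_pow_diff m_assoc)
    also have "\<dots> = a [^] (if even j then - i else i) \<otimes> b [^] (j - 1)"
      using a b step2(2)[of "- i"] by (simp add: int_pow_diff m_assoc)
    finally show ?case by (simp add: if_distrib)
  qed
qed

lemma group_reversal_group: "group (reversal_group r)"
  unfolding reversal_group_def by (rule group_presented_group)

lemma elt_closed [simp]:
  "elt_a r \<in> carrier (reversal_group r)" "elt_b r \<in> carrier (reversal_group r)"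
  by (simp_all add: elt_a_def elt_b_def reversal_group_def)

text \<open>The defining relation contains the formal letter \<open>(Gen_a, False)\<close>; by
  \<open>cancel\<close> its class is the group inverse of \<open>elt_a r\<close>.\<close>

lemma elt_a_elt_b:
  "elt_a r \<otimes>\<^bsub>reversal_group r\<^esub> elt_b r = elt_b r \<otimes>\<^bsub>reversal_group r\<^esub> inv\<^bsub>reversal_group r\<^esub> elt_a r"
proof -
  interpret P: group "presented_group (reversal_rels r)" by (rule group_presented_group)
  have "inv\<^bsub>presented_group (reversal_rels r)\<^esub> word_class (reversal_rels r) [(Gen_a, True)] =
      word_class (reversal_rels r) [(Gen_a, False)]"
    using word_eq.cancel[of "reversal_rels r" Gen_a False]
    by (intro P.inv_equality) (auto simp: word_class_eq_iff)
  then show ?thesis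
    by (simp add: reversal_group_def elt_a_def elt_b_def word_class_eq_iff)
      (rule word_eq.rel, simp add: reversal_rels_def)
qed

section \<open>The normal form homomorphism and its kernel\<close>

definition nf :: "nat \<Rightarrow> int \<times> int \<Rightarrow> gen word set" where
  "nf r p = elt_a r [^]\<^bsub>reversal_group r\<^esub> fst p \<otimes>\<^bsub>reversal_group r\<^esub> elt_b r [^]\<^bsub>reversal_group r\<^esub> snd p"

text \<open>Moving \<open>b\<close> past \<open>a\<close> by \<open>twisted_commutation\<close>
  produces exactly the twisted product. Through this homomorphism subgroups of the reversal group
  are studied inside \<open>twist\<close>.\<close>

lemma nf_hom: "group_hom twist (reversal_group r) (nf r)"
proof -
  interpret G: group "reversal_group r" by (rule group_reversal_group)
  let ?a = "elt_a r" and ?b = "elt_b r"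
  have "nf r (p \<otimes>\<^bsub>twist\<^esub> q) = nf r p \<otimes>\<^bsub>reversal_group r\<^esub> nf r q" for p q
  proof -
    obtain i j i' j' where pq: "p = (i, j)" "q = (i', j')" by fastforce
    have "nf r p \<otimes>\<^bsub>reversal_group r\<^esub> nf r q =
      ?a [^]\<^bsub>reversal_group r\<^esub> i \<otimes>\<^bsub>reversal_group r\<^esub>
        (?b [^]\<^bsub>reversal_group r\<^esub> j \<otimes>\<^bsub>reversal_group r\<^esub> ?a [^]\<^bsub>reversal_group r\<^esub> i')
        \<otimes>\<^bsub>reversal_group r\<^esub> ?b [^]\<^bsub>reversal_group r\<^esub> j'"
      by (simp add: nf_def pq G.m_assoc)
    also have "\<dots> = nf r (p \<otimes>\<^bsub>twist\<^esub> q)"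
      unfolding G.twisted_commutation[OF elt_closed elt_a_elt_b]
      by (simp add: nf_def pq G.m_assoc G.int_pow_mult)
    finally show ?thesis by simp
  qed
  moreover have "nf r p \<in> carrier (reversal_group r)" for p by (simp add: nf_def)
  ultimately show ?thesis
    unfolding group_hom_def group_hom_axioms_def
    by (auto intro: homI simp: group_twist G.is_group)
qed

interpretation nf: group_hom twist "reversal_group r" "nf r" for r
  by (rule nf_hom)

abbreviation coord_gen :: "gen \<Rightarrow> int \<times> int" where
  "coord_gen \<equiv> case_gen (1, 0) (0, 1)"

text \<open>The exponents of the normal form of a word when only \<open>ab = ba^-1\<close> is
  imposed, so the second exponent is an integer and not yet a residue modulo
  \<open>2 * r\<close>.\<close>

definition coord :: "gen word \<Rightarrow> int \<times> int" where
  "coord = word_value twist coord_gen"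

lemma coord_append: "coord (u @ v) = coord u \<otimes>\<^bsub>twist\<^esub> coord v"
  unfolding coord_def by (rule word_value_append[OF group_twist]) simp

lemma word_class_eq_nf: "word_class (reversal_rels r) u = nf r (coord u)"
proof -
  let ?c = "word_class (reversal_rels r)"
  interpret P: group "presented_group (reversal_rels r)" by (rule group_presented_group)
  have pos: "?c [(g, True)] = nf r (coord_gen g)" for g
    by (cases g) (simp_all add: nf_def flip: elt_a_def elt_b_def)
  have "?c [(g, False)] = inv\<^bsub>reversal_group r\<^esub> ?c [(g, True)]" for g
    unfolding reversal_group_def using word_eq.cancel[of "reversal_rels r" g False]
    by (intro P.inv_equality[symmetric]) (auto simp: word_class_eq_iff)
  then have neg: "?c [(g, False)] = nf r (inv\<^bsub>twist\<^esub> coord_gen g)" for g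
    by (simp only: pos nf.hom_inv carrier_twist UNIV_I)
  show ?thesis
  proof (induction u)
    case Nil
    show ?case using nf.hom_one[of r] by (simp add: coord_def reversal_group_def)
  next
    case (Cons x u)
    obtain g e where x: "x = (g, e)" by fastforce
    have "?c (x # u) = ?c [x] \<otimes>\<^bsub>reversal_group r\<^esub> ?c u" by (simp add: reversal_group_def)
    also have "?c [x] = nf r (if e then coord_gen g else inv\<^bsub>twist\<^esub> coord_gen g)"
      by (cases e) (simp_all only: x pos neg if_True if_False)
    also have "\<dots> \<otimes>\<^bsub>reversal_group r\<^esub> ?c u = nf r (coord (x # u))"
      by (cases e) (simp_all add: Cons x coord_def)
    finally show ?case .
  qed
qed

lemma range_nf: "range (nf r) = carrier (reversal_group r)"
proof
  show "carrier (reversal_group r) \<subseteq> range (nf r)"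
    unfolding reversal_group_def carrier_presented_group by (auto simp: word_class_eq_nf)
qed auto

text \<open>Words for \<open>(0, j)\<close> are built first and letters for \<open>a\<close> are
  prefixed afterwards, since prefixing a letter for \<open>b\<close> negates the first
  coordinate.\<close>

lemma ex_coord: "\<exists>u. coord u = p"
proof -
  have b: "\<exists>u. coord u = (0, j)" for j
  proof (induction j rule: int_induct[of _ 0])
    case base
    show ?case by (rule exI[of _ "[]"]) (simp add: coord_def)
  next
    case (step1 j)
    then obtain u where "coord u = (0, j)" by blast
    then have "coord ((Gen_b, True) # u) = (0, j + 1)" by (simp add: coord_def)
    then show ?case by blast
  next
    case (step2 j)
    then obtain u where "coord u = (0, j)" by blast
    then have "coord ((Gen_b, False) # u) = (0, j - 1)" by (simp add: coord_def)
    then show ?case by blast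
  qed
  have "\<exists>u. coord u = (i, j)" for i j
  proof (induction i rule: int_induct[of _ 0])
    case base
    show ?case by (rule b)
  next
    case (step1 i)
    then obtain u where "coord u = (i, j)" by blast
    then have "coord ((Gen_a, True) # u) = (i + 1, j)" by (simp add: coord_def)
    then show ?case by blast
  next
    case (step2 i)
    then obtain u where "coord u = (i, j)" by blast
    then have "coord ((Gen_a, False) # u) = (i - 1, j)" by (simp add: coord_def)
    then show ?case by blast
  qed
  then show ?thesis by (cases p) auto
qed

text \<open>This invariant of words shows that the presented group does not collapse: equal normal
  forms have equal exponents of \<open>a\<close>, and exponents of \<open>b\<close> congruent modulo
  \<open>2 * r\<close>.\<close>

lemma word_eq_coord:
  assumes "word_eq (reversal_rels r) u v"
  shows "fst (coord u) = fst (coord v) \<and> 2 * int r dvd snd (coord u) - snd (coord v)"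
  using assms
proof induction
  case (rel u v)
  have "coord (replicate n (Gen_b, True)) = (0, int n)" for n
    by (induction n) (simp_all add: coord_def)
  then show ?case
    using rel by (auto simp: reversal_rels_def) (simp_all add: coord_def)
next
  case (cancel g e)
  have "coord [(g, e), (g, \<not> e)] = coord []"
    by (cases g; cases e) (simp_all add: coord_def)
  then show ?case by simp
next
  case (congr u v p q)
  obtain x y x' y' z w z' w' where c: "coord u = (x, y)" "coord v = (x', y')" "coord p = (z, w)" "coord q = (z', w')"
    by fastforce
  then have *: "x = x'" "2 * int r dvd y - y'" using congr by auto
  \<comment> \<open>The sign with which the coordinate of \<open>q\<close> enters depends on the
    parity of \<open>y\<close>; it is preserved because the modulus \<open>2 * r\<close> is
    even.\<close>
  then have "even (y - y')" by (meson dvd_mult_left)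
  then have "even y \<longleftrightarrow> even y'" by simp
  then show ?case using * by (simp add: c coord_append)
next
  case (trans u v w)
  then show ?case using dvd_add[of "2 * int r" "snd (coord u) - snd (coord v)" "snd (coord v) - snd (coord w)"]
    by simp
qed (auto simp: dvd_diff_commute)

text \<open>The kernel is generated by \<open>(0, 2 * r)\<close>: the invariant
  \<open>word_eq_coord\<close> bounds it from above, and the relation \<open>b^(2r) = 1\<close> from
  below.\<close>

lemma nf_eq_one_iff: "nf r p = \<one>\<^bsub>reversal_group r\<^esub> \<longleftrightarrow> fst p = 0 \<and> 2 * int r dvd snd p"
proof
  assume "nf r p = \<one>\<^bsub>reversal_group r\<^esub>"
  moreover obtain u where u: "coord u = p" using ex_coord by blast
  ultimately have "word_class (reversal_rels r) u = word_class (reversal_rels r) []"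
    by (simp add: word_class_eq_nf u) (simp add: reversal_group_def word_class_eq_nf)
  then show "fst p = 0 \<and> 2 * int r dvd snd p"
    using word_eq_coord[of r u "[]"] u by (simp add: word_class_eq_iff) (simp add: coord_def)
next
  assume *: "fst p = 0 \<and> 2 * int r dvd snd p"
  have "word_class (reversal_rels r) (replicate (2 * r) (Gen_b, True)) = word_class (reversal_rels r) []"
    by (auto simp: word_class_eq_iff reversal_rels_def intro: word_eq.rel)
  moreover have "coord (replicate n (Gen_b, True)) = (0, int n)" for n
    by (induction n) (simp_all add: coord_def)
  ultimately have "nf r (0, 2 * int r) = \<one>\<^bsub>reversal_group r\<^esub>"
    by (simp add: word_class_eq_nf) (simp add: coord_def flip: nf.hom_one)
  then have "(0, 2 * int r) \<in> kernel twist (reversal_group r) (nf r)" by (simp add: kernel_def)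
  then have "(0, 2 * int r) [^]\<^bsub>twist\<^esub> c \<in> kernel twist (reversal_group r) (nf r)" for c :: int
    by (rule twist.subgroup_int_pow_closed[OF nf.subgroup_kernel])
  moreover have "(0, 2 * int r) [^]\<^bsub>twist\<^esub> c = (0, 2 * int r * c)" for c :: int
    by (rule twist_int_pow) (simp_all add: algebra_simps)
  moreover obtain c where "p = (0, 2 * int r * c)" using * by (metis dvdE prod.collapse)
  ultimately show "nf r p = \<one>\<^bsub>reversal_group r\<^esub>" by (simp add: kernel_def)
qed

text \<open>A subgroup that contains the generator of the kernel is a union of fibres of
  \<open>nf\<close>, so membership can be tested in \<open>twist\<close>.\<close>

lemma nf_mem_image_iff:
  assumes S: "subgroup S twist" and r: "(0, 2 * int r) \<in> S"
  shows "nf r p \<in> nf r ` S \<longleftrightarrow> p \<in> S"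
proof
  assume "nf r p \<in> nf r ` S"
  then obtain q where q: "q \<in> S" "nf r p = nf r q" by blast
  have "nf r (p \<otimes>\<^bsub>twist\<^esub> inv\<^bsub>twist\<^esub> q) = \<one>\<^bsub>reversal_group r\<^esub>"
    using nf.hom_mult[of p "inv\<^bsub>twist\<^esub> q" r] nf.hom_inv[of q r] q(2) by simp
  then obtain c where "p \<otimes>\<^bsub>twist\<^esub> inv\<^bsub>twist\<^esub> q = (0, 2 * int r * c)"
    unfolding nf_eq_one_iff by (metis dvdE prod.collapse)
  also have "\<dots> = (0, 2 * int r) [^]\<^bsub>twist\<^esub> c"
    by (rule twist_int_pow[symmetric]) (simp_all add: algebra_simps)
  also have "\<dots> \<in> S" by (rule twist.subgroup_int_pow_closed[OF S r])
  finally have "p \<otimes>\<^bsub>twist\<^esub> inv\<^bsub>twist\<^esub> q \<otimes>\<^bsub>twist\<^esub> q \<in> S"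
    using q S by (simp only: subgroup.m_closed)
  then show "p \<in> S"
    by (metis UNIV_I carrier_twist twist.inv_closed twist.l_inv twist.m_assoc twist.r_one)
qed simp

section \<open>Transversals and indices\<close>

lemma bij_betw_rcosets_nf:
  assumes S: "subgroup S twist" and r: "(0, 2 * int r) \<in> S"
    and ex: "\<And>p. \<exists>q\<in>I. p \<otimes>\<^bsub>twist\<^esub> inv\<^bsub>twist\<^esub> q \<in> S"
    and inj: "\<And>p q. p \<in> I \<Longrightarrow> q \<in> I \<Longrightarrow> p \<otimes>\<^bsub>twist\<^esub> inv\<^bsub>twist\<^esub> q \<in> S \<Longrightarrow> p = q"
  shows "bij_betw (\<lambda>p. nf r ` S #>\<^bsub>reversal_group r\<^esub> nf r p) I (rcosets\<^bsub>reversal_group r\<^esub> (nf r ` S))"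
proof -
  have *: "nf r p \<otimes>\<^bsub>reversal_group r\<^esub> inv\<^bsub>reversal_group r\<^esub> nf r q \<in> nf r ` S \<longleftrightarrow>
      p \<otimes>\<^bsub>twist\<^esub> inv\<^bsub>twist\<^esub> q \<in> S" for p q
    using nf_mem_image_iff[OF S r, of "p \<otimes>\<^bsub>twist\<^esub> inv\<^bsub>twist\<^esub> q"] by simp
  show ?thesis
  proof (rule nf.H.bij_betw_rcosets_transversal)
    show "subgroup (nf r ` S) (reversal_group r)" by (rule nf.subgroup_img_is_subgroup[OF S])
  next
    fix g assume "g \<in> carrier (reversal_group r)"
    then obtain p where "g = nf r p" using range_nf by blast
    then show "\<exists>q\<in>I. g \<otimes>\<^bsub>reversal_group r\<^esub> inv\<^bsub>reversal_group r\<^esub> nf r q \<in> nf r ` S"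
      using ex[of p] * by simp
  qed (use inj * in auto)
qed

text \<open>The rectangle \<open>?I\<close> of size \<open>m\<close> times \<open>2 * k\<close> is a
  transversal: reduce the first coordinate modulo \<open>m\<close>, then the second modulo
  \<open>2 * k\<close> after subtracting the shift \<open>2 * l * u\<close> caused by the first
  reduction.\<close>

lemma even_type_index:
  fixes k m r :: nat and l :: int
  assumes "k > 0" "m > 0" "k dvd r"
  defines "H \<equiv> nf r ` even_type (int k) (int m) l"
  shows "finite_index_subgroup (reversal_group r) H" "card (rcosets\<^bsub>reversal_group r\<^esub> H) = 2 * k * m"
proof -
  have sub: "subgroup (even_type (int k) (int m) l) twist" by (rule subgroup_even_type)
  let ?I = "{0..<int m} \<times> {0..<2 * int k}"
  obtain c where c: "r = k * c" using assms by blast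
  have r: "(0, 2 * int r) \<in> even_type (int k) (int m) l"
    unfolding even_type_iff c by (intro exI[of _ 0] exI[of _ "int c"]) simp
  have bij: "bij_betw (\<lambda>p. H #>\<^bsub>reversal_group r\<^esub> nf r p) ?I (rcosets\<^bsub>reversal_group r\<^esub> H)"
    unfolding H_def
  proof (rule bij_betw_rcosets_nf[OF sub r])
    fix p :: "int \<times> int"
    obtain x y where p: "p = (x, y)" by fastforce
    define u where "u = x div int m"
    define v where "v = (y - 2 * l * u) div (2 * int k)"
    have "x = int m * u + x mod int m" by (simp add: u_def)
    moreover have "y = 2 * l * u + 2 * int k * v + (y - 2 * l * u) mod (2 * int k)"
      unfolding v_def by (metis add.commute add_diff_cancel_left' diff_add_cancel mult_div_mod_eq add.assoc)
    ultimately have eq: "p = (int m * u + x mod int m, 2 * l * u + 2 * int k * v + (y - 2 * l * u) mod (2 * int k))"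
      using p by simp
    define x' y' where xy': "x' = x mod int m" "y' = (y - 2 * l * u) mod (2 * int k)"
    have "p \<otimes>\<^bsub>twist\<^esub> inv\<^bsub>twist\<^esub> (x', y') = (int m * u, 2 * l * u + 2 * int k * v)"
      unfolding eq xy'[symmetric] by simp
    then have "p \<otimes>\<^bsub>twist\<^esub> inv\<^bsub>twist\<^esub> (x', y') \<in> even_type (int k) (int m) l"
      unfolding even_type_def by blast
    moreover have "(x', y') \<in> ?I" using assms by (simp add: xy')
    ultimately show "\<exists>q\<in>?I. p \<otimes>\<^bsub>twist\<^esub> inv\<^bsub>twist\<^esub> q \<in> even_type (int k) (int m) l" by blast
  next
    fix p q assume pq: "p \<in> ?I" "q \<in> ?I" "p \<otimes>\<^bsub>twist\<^esub> inv\<^bsub>twist\<^esub> q \<in> even_type (int k) (int m) l"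
    obtain x y x' y' where c: "p = (x, y)" "q = (x', y')" by fastforce
    obtain u v where uv: "p \<otimes>\<^bsub>twist\<^esub> inv\<^bsub>twist\<^esub> q = (int m * u, 2 * l * u + 2 * int k * v)"
      using pq(3) unfolding even_type_def by blast
    then have "y - y' = 2 * (l * u + int k * v)" using c by (simp split: if_splits)
    then have "even (y - y')" by simp
    then have "x - x' = int m * u" using uv c by (simp split: if_splits)
    then have "int m dvd x - x'" by simp
    then have x: "x = x'" using pq c by (simp add: mod_eq_dvd_iff[symmetric])
    then have "u = 0" using \<open>x - x' = int m * u\<close> assms by simp
    then have "2 * int k dvd y - y'" using uv c by (simp split: if_splits)
    then have "y = y'" using pq c by (simp add: mod_eq_dvd_iff[symmetric])
    then show "p = q" using x c by simp
  qed
  show "finite_index_subgroup (reversal_group r) H"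
    unfolding finite_index_subgroup_def H_def using nf.subgroup_img_is_subgroup[OF sub]
      bij_betw_finite[OF bij] H_def by simp
  show "card (rcosets\<^bsub>reversal_group r\<^esub> H) = 2 * k * m"
    using bij_betw_same_card[OF bij] by (simp add: card_cartesian_product nat_mult_distrib mult.commute)
qed

lemma odd_type_index:
  fixes j m r :: nat and i :: int
  assumes "odd j" "m > 0" "j dvd r"
  defines "H \<equiv> nf r ` odd_type (int j) (int m) i"
  shows "finite_index_subgroup (reversal_group r) H" "card (rcosets\<^bsub>reversal_group r\<^esub> H) = j * m"
proof -
  have j: "j > 0" using \<open>odd j\<close> by (rule odd_pos)
  have sub: "subgroup (odd_type (int j) (int m) i) twist" using assms by (simp add: subgroup_odd_type)
  let ?I = "{0..<int m} \<times> {0..<int j}"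
  obtain c where c: "r = j * c" using assms by blast
  have r: "(0, 2 * int r) \<in> odd_type (int j) (int m) i"
    unfolding odd_type_iff c by (intro exI[of _ 0] exI[of _ "2 * int c"]) simp
  have bij: "bij_betw (\<lambda>p. H #>\<^bsub>reversal_group r\<^esub> nf r p) ?I (rcosets\<^bsub>reversal_group r\<^esub> H)"
    unfolding H_def
  proof (rule bij_betw_rcosets_nf[OF sub r])
    fix p :: "int \<times> int"
    obtain x y where p: "p = (x, y)" by fastforce
    define v where "v = y div int j"
    \<comment> \<open>If \<open>v\<close> is odd, right division by \<open>(x', y')\<close> adds
      \<open>x'\<close> to \<open>x\<close>. The sum has to be congruent to \<open>i\<close>, so
      \<open>x'\<close> is the remainder of \<open>i - x\<close>.\<close>
    define x' where "x' = (if even v then x mod int m else (i - x) mod int m)"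
    define u where "u = (if even v then x div int m else - ((i - x) div int m))"
    have x: "x = int m * u + (if even v then x' else i - x')"
    proof (cases "even v")
      case False
      define d e where "d = (i - x) div int m" and "e = (i - x) mod int m"
      then have "i - x = int m * d + e" by (simp only: mult_div_mod_eq)
      moreover have "u = - d" "x' = e" using False by (simp_all only: u_def x'_def d_def e_def if_False)
      ultimately show ?thesis using False by simp
    qed (simp add: u_def x'_def)
    have y: "y = int j * v + y mod int j" by (simp add: v_def)
    define y' where "y' = y mod int j"
    have "even (y - y') \<longleftrightarrow> even v" using y \<open>odd j\<close> unfolding y'_def[symmetric] by simp
    moreover have "p \<otimes>\<^bsub>twist\<^esub> inv\<^bsub>twist\<^esub> (x', y') = (x + (if even (y - y') then - x' else x'), y - y')"
      by (simp add: p)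
    ultimately have "p \<otimes>\<^bsub>twist\<^esub> inv\<^bsub>twist\<^esub> (x', y') = (int m * u + (if even v then 0 else i), int j * v)"
      using x y unfolding y'_def[symmetric] by (simp split: if_splits)
    then have "p \<otimes>\<^bsub>twist\<^esub> inv\<^bsub>twist\<^esub> (x', y') \<in> odd_type (int j) (int m) i"
      unfolding odd_type_def by blast
    moreover have "(x', y') \<in> ?I" using assms j by (simp add: x'_def y'_def)
    ultimately show "\<exists>q\<in>?I. p \<otimes>\<^bsub>twist\<^esub> inv\<^bsub>twist\<^esub> q \<in> odd_type (int j) (int m) i" by blast
  next
    fix p q assume pq: "p \<in> ?I" "q \<in> ?I" "p \<otimes>\<^bsub>twist\<^esub> inv\<^bsub>twist\<^esub> q \<in> odd_type (int j) (int m) i"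
    obtain x y x' y' where c: "p = (x, y)" "q = (x', y')" by fastforce
    obtain u v where uv: "p \<otimes>\<^bsub>twist\<^esub> inv\<^bsub>twist\<^esub> q = (int m * u + (if even v then 0 else i), int j * v)"
      using pq(3) unfolding odd_type_def by blast
    then have "y - y' = int j * v" using c by (simp split: if_splits)
    moreover from this have "int j dvd y - y'" by simp
    then have y: "y = y'" using pq c by (simp add: mod_eq_dvd_iff[symmetric])
    ultimately have "v = 0" using j by simp
    then have "x - x' = int m * u" using uv c y by (simp split: if_splits)
    then have "int m dvd x - x'" by simp
    then have "x = x'" using pq c by (simp add: mod_eq_dvd_iff[symmetric])
    then show "p = q" using y c by simp
  qed
  show "finite_index_subgroup (reversal_group r) H"
    unfolding finite_index_subgroup_def H_def using nf.subgroup_img_is_subgroup[OF sub]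
      bij_betw_finite[OF bij] H_def by simp
  show "card (rcosets\<^bsub>reversal_group r\<^esub> H) = j * m"
    using bij_betw_same_card[OF bij] by (simp add: card_cartesian_product mult.commute)
qed

section \<open>Classification of the finite-index subgroups\<close>

text \<open>Pigeonhole: the powers of \<open>x\<close> meet only finitely many cosets, so two of
  them share a coset and their quotient is a power of \<open>x\<close> in \<open>H\<close>.\<close>

lemma (in group) finite_index_power_mem:
  assumes "finite_index_subgroup G H" "x \<in> carrier G"
  shows "\<exists>n > 0. x [^] (n :: nat) \<in> H"
proof -
  have H: "subgroup H G" "finite (rcosets H)" using assms by (simp_all add: finite_index_subgroup_def)
  have "(\<lambda>n :: nat. H #> x [^] n) ` UNIV \<subseteq> rcosets H"
    using assms by (auto intro!: rcosetsI subgroup.subset[OF H(1)])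
  then have "finite (range (\<lambda>n :: nat. H #> x [^] n))" using H(2) finite_subset by blast
  then have "\<not> inj (\<lambda>n :: nat. H #> x [^] n)" using finite_imageD infinite_UNIV_nat by blast
  then obtain n n' where "H #> x [^] n = H #> x [^] n'" "n < (n' :: nat)"
    unfolding inj_def by (metis linorder_neqE_nat)
  then have "x [^] n' \<in> H #> x [^] n"
    using rcos_self[of "x [^] n'" H] H assms by simp
  then have "x [^] n' \<otimes> inv (x [^] n) \<in> H"
    using subgroup.rcos_module[OF H(1) is_group] assms by simp
  moreover have "x [^] n' = x [^] (n' - n) \<otimes> x [^] n"
    using \<open>n < n'\<close> assms by (simp add: nat_pow_mult)
  ultimately have "x [^] (n' - n) \<in> H" using assms by (simp add: m_assoc)
  then show ?thesis using \<open>n < n'\<close> by (intro exI[of _ "n' - n"]) simp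
qed

text \<open>The preimage of \<open>H\<close> under \<open>nf\<close> contains
  \<open>(0, 2 * r)\<close> from the kernel and, by finite index, some \<open>(n, 0)\<close> with
  \<open>n > 0\<close>; \<open>twist_subgroup_cases\<close> then applies.\<close>

lemma finite_index_subgroup_cases:
  assumes H: "finite_index_subgroup (reversal_group r) H" and r: "r > 0"
  obtains (even) k m l where "H = nf r ` even_type (int k) (int m) (int l)"
      "k > 0" "k dvd r" "m > 0" "l < k"
    | (odd) j m i where "H = nf r ` odd_type (int j) (int m) (int i)"
      "odd j" "j dvd r" "m > 0" "i < m"
proof -
  have sub: "subgroup H (reversal_group r)" using H by (simp add: finite_index_subgroup_def)
  define S where "S = {p. nf r p \<in> H}"
  have HS: "H = nf r ` S"
  proof
    show "H \<subseteq> nf r ` S"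
    proof
      fix h assume "h \<in> H"
      then have "h \<in> range (nf r)" using subgroup.subset[OF sub] range_nf by blast
      then show "h \<in> nf r ` S" using \<open>h \<in> H\<close> by (auto simp: S_def)
    qed
  qed (auto simp: S_def)
  have S: "subgroup S twist"
  proof (rule subgroup_twistI)
    show "(0, 0) \<in> S" using nf.hom_one[of r] subgroup.one_closed[OF sub] by (simp add: S_def)
    show "p \<otimes>\<^bsub>twist\<^esub> inv\<^bsub>twist\<^esub> q \<in> S" if "p \<in> S" "q \<in> S" for p q
      using that nf.hom_mult[of p "inv\<^bsub>twist\<^esub> q" r] nf.hom_inv[of q r] sub
      by (simp add: S_def subgroup.m_closed subgroup.m_inv_closed)
  qed
  obtain n where n: "n > 0" "elt_a r [^]\<^bsub>reversal_group r\<^esub> (n :: nat) \<in> H"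
    using nf.H.finite_index_power_mem[OF H] elt_closed by blast
  then have c: "(int n, 0) \<in> S" by (simp add: S_def nf_def int_pow_int)
  have "nf r (0, 2 * int r) = \<one>\<^bsub>reversal_group r\<^esub>" by (simp add: nf_eq_one_iff)
  then have "(0, 2 * int r) \<in> S" using subgroup.one_closed[OF sub] by (simp add: S_def)
  show thesis
  proof (rule twist_subgroup_cases[OF S c _ \<open>(0, 2 * int r) \<in> S\<close>])
    fix k m l
    assume "S = even_type k m l" "k > 0" "k dvd int r" "m > 0" "0 \<le> l" "l < k"
    then show thesis using even[of "nat k" "nat m" "nat l"] HS r by (simp add: nat_dvd_iff)
  next
    fix j m i
    assume "S = odd_type j m i" "j > 0" "odd j" "j dvd int r" "m > 0" "0 \<le> i" "i < m"
    then show thesis using odd[of "nat j" "nat m" "nat i"] HS r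
      by (simp add: nat_dvd_iff even_nat_iff)
  qed (use n r in auto)
qed

section \<open>Fixed points\<close>

locale reversal_action =
  fixes r :: nat and X :: "'a topology" and T R :: "'a \<Rightarrow> 'a" and \<alpha> :: "gen word set \<Rightarrow> 'a \<Rightarrow> 'a"
  assumes r_pos: "r > 0" and is_action: "is_reversal_action r X T R \<alpha>"
begin

sublocale group_action "reversal_group r" "topspace X" \<alpha>
  using is_action by (simp add: is_reversal_action_def)

text \<open>The stabilizer of \<open>x\<close> pulled back along \<open>nf\<close>. For points of
  the space it is a subgroup of \<open>twist\<close>, so fixedness under a subgroup can be tested on
  generators.\<close>

definition stab :: "'a \<Rightarrow> (int \<times> int) set" where
  "stab x = {p. \<alpha> (nf r p) x = x}"

lemma nf_closed: "nf r p \<in> carrier (reversal_group r)"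
  by simp

lemma action_mult: "x \<in> topspace X \<Longrightarrow> \<alpha> (nf r (p \<otimes>\<^bsub>twist\<^esub> q)) x = \<alpha> (nf r p) (\<alpha> (nf r q) x)"
  by (simp add: composition_rule)

lemma action_one: "x \<in> topspace X \<Longrightarrow> \<alpha> (nf r (0, 0)) x = x"
  using nf.hom_one[of r] id_eq_one by (metis one_twist restrict_apply')

lemma action_closed: "x \<in> topspace X \<Longrightarrow> \<alpha> (nf r p) x \<in> topspace X"
  using element_image nf_closed by blast

lemma action_inv_left: "x \<in> topspace X \<Longrightarrow> \<alpha> (nf r (inv\<^bsub>twist\<^esub> p)) (\<alpha> (nf r p) x) = x"
  by (metis UNIV_I action_mult action_one carrier_twist one_twist twist.l_inv)

lemma subgroup_stab:
  assumes "x \<in> topspace X"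
  shows "subgroup (stab x) twist"
proof (rule subgroup_twistI)
  show "(0, 0) \<in> stab x" using assms by (simp add: stab_def action_one)
  show "p \<otimes>\<^bsub>twist\<^esub> inv\<^bsub>twist\<^esub> q \<in> stab x" if "p \<in> stab x" "q \<in> stab x" for p q
    using that action_inv_left[OF assms, of q] action_mult[OF assms, of p "inv\<^bsub>twist\<^esub> q"]
    by (simp only: stab_def mem_Collect_eq)
qed

lemma action_nf:
  assumes "x \<in> topspace X"
  shows "\<alpha> (nf r (int i, int j)) x = (T ^^ i) ((R ^^ j) x)"
proof -
  have T: "\<alpha> (nf r (1, 0)) y = T y" and R: "\<alpha> (nf r (0, 1)) y = R y" if "y \<in> topspace X" for y
    using is_action that by (simp_all add: is_reversal_action_def nf_def)
  have Rj: "\<alpha> (nf r (0, int j)) x = (R ^^ j) x" for j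
  proof (induction j)
    case 0
    then show ?case using assms by (simp add: action_one)
  next
    case (Suc j)
    have "\<alpha> (nf r (0, int (Suc j))) x = \<alpha> (nf r (0, 1)) (\<alpha> (nf r (0, int j)) x)"
      using action_mult[OF assms, of "(0, 1)" "(0, int j)"] by simp
    also have "\<dots> = R (\<alpha> (nf r (0, int j)) x)"
      by (rule R[OF action_closed[OF assms]])
    finally show ?case using Suc by simp
  qed
  show ?thesis
  proof (induction i)
    case 0
    then show ?case by (simp add: Rj)
  next
    case (Suc i)
    have "\<alpha> (nf r (int (Suc i), int j)) x = \<alpha> (nf r (1, 0)) (\<alpha> (nf r (int i, int j)) x)"
      using action_mult[OF assms, of "(1, 0)" "(int i, int j)"] by (simp add: add.commute)
    also have "\<dots> = T (\<alpha> (nf r (int i, int j)) x)"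
      by (rule T[OF action_closed[OF assms]])
    finally show ?case using Suc by simp
  qed
qed

lemma stab_iff:
  assumes "x \<in> topspace X"
  shows "(int i, int j) \<in> stab x \<longleftrightarrow> (T ^^ i) ((R ^^ j) x) = x"
  by (simp add: stab_def action_nf[OF assms])

lemma fixed_points_nf_image:
  "fixed_points (topspace X) \<alpha> (nf r ` S) = {x \<in> topspace X. S \<subseteq> stab x}"
  by (auto simp: fixed_points_def stab_def)

text \<open>Only the two generators need to be tested: \<open>(0, 2 * k)\<close> gives membership in
  the subsystem, and \<open>(m, 2 * l)\<close> gives the remaining equation.\<close>

lemma fixed_points_even_type:
  "fixed_points (topspace X) \<alpha> (nf r ` even_type (int k) (int m) (int l)) =
    {x \<in> subsystem X R (2 * k). (T ^^ m) ((R ^^ (2 * l)) x) = x}"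
proof -
  have "even_type (int k) (int m) (int l) \<subseteq> stab x \<longleftrightarrow>
      (int m, int (2 * l)) \<in> stab x \<and> (int 0, int (2 * k)) \<in> stab x" if "x \<in> topspace X" for x
  proof
    have "(int m, 2 * int l) \<in> even_type (int k) (int m) (int l)"
      unfolding even_type_iff by (rule exI[of _ 1], rule exI[of _ 0]) simp
    moreover have "(0, 2 * int k) \<in> even_type (int k) (int m) (int l)"
      unfolding even_type_iff by (rule exI[of _ 0], rule exI[of _ 1]) simp
    moreover assume "even_type (int k) (int m) (int l) \<subseteq> stab x"
    ultimately show "(int m, int (2 * l)) \<in> stab x \<and> (int 0, int (2 * k)) \<in> stab x" by auto
  qed (use even_type_subset[OF subgroup_stab[OF that]] in simp)
  then show ?thesis
    unfolding fixed_points_nf_image subsystem_def by (auto simp: stab_iff simp del: of_nat_mult of_nat_0)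
qed

lemma fixed_points_odd_type:
  assumes "odd j"
  shows "fixed_points (topspace X) \<alpha> (nf r ` odd_type (int j) (int m) i) =
    {x \<in> topspace X. (int m, 0) \<in> stab x \<and> (i, int j) \<in> stab x}"
proof -
  have "odd_type (int j) (int m) i \<subseteq> stab x \<longleftrightarrow> (int m, 0) \<in> stab x \<and> (i, int j) \<in> stab x"
    if "x \<in> topspace X" for x
  proof
    have "(int m, 0) \<in> odd_type (int j) (int m) i"
      unfolding odd_type_iff by (rule exI[of _ 1], rule exI[of _ 0]) simp
    moreover have "(i, int j) \<in> odd_type (int j) (int m) i"
      unfolding odd_type_iff by (rule exI[of _ 0], rule exI[of _ 1]) simp
    moreover assume "odd_type (int j) (int m) i \<subseteq> stab x"
    ultimately show "(int m, 0) \<in> stab x \<and> (i, int j) \<in> stab x" by auto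
  qed (use odd_type_subset[OF subgroup_stab[OF that]] assms in simp)
  then show ?thesis
    unfolding fixed_points_nf_image by auto
qed

section \<open>Counting the fixed points of the second family\<close>

text \<open>The index \<open>i\<close> is not confined to \<open>i < m\<close>, so that invariance
  under shifts of \<open>i\<close> can be stated without reductions modulo \<open>m\<close>.\<close>

definition flip_fix :: "nat \<Rightarrow> nat \<Rightarrow> nat \<Rightarrow> nat" where
  "flip_fix j m i = card (fixed_points (topspace X) \<alpha> (nf r ` odd_type (int j) (int m) (int i)))"

text \<open>For odd \<open>j\<close> the square of \<open>(i, j)\<close> is
  \<open>(0, 2 * j)\<close>, so a point fixed by \<open>(i, j)\<close> automatically lies in the
  subsystem of points with \<open>R^(2j) x = x\<close>.\<close>

lemma flip_count_eq_flip_fix: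
  assumes "odd j"
  shows "flip_count (subsystem X R (2 * j)) T (R ^^ j) m i = flip_fix j m i"
proof -
  have "(R ^^ (2 * j)) x = x" if x: "x \<in> topspace X" "(int i, int j) \<in> stab x" for x
  proof -
    have "(int i, int j) \<otimes>\<^bsub>twist\<^esub> (int i, int j) \<in> stab x"
      using subgroup.m_closed[OF subgroup_stab[OF x(1)] x(2) x(2)] .
    then have "(int 0, int (2 * j)) \<in> stab x" using assms by simp
    then show ?thesis unfolding stab_iff[OF x(1)] by simp
  qed
  then show ?thesis
    unfolding flip_fix_def flip_count_def fixed_points_odd_type[OF assms] subsystem_def
    using stab_iff[of _ m 0] stab_iff[of _ i j] by (intro arg_cong[where f = card]) auto
qed

text \<open>Conjugation by \<open>a\<close> shifts the exponent of \<open>a\<close> in \<open>a\<^sup>i b\<^sup>j\<close> by two when \<open>j\<close> is odd.\<close>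

lemma flip_fix_add_2:
  assumes "odd j"
  shows "flip_fix j m (i + 2) = flip_fix j m i"
proof -
  let ?F = "\<lambda>i. {x \<in> topspace X. (int m, 0) \<in> stab x \<and> (i, int j) \<in> stab x}"
  \<comment> \<open>Moving a point by \<open>c\<close> conjugates its stabilizer by
    \<open>c\<close>. For \<open>c = (1, 0)\<close> this fixes \<open>(m, 0)\<close> and sends
    \<open>(i, j)\<close> to \<open>(i + 2, j)\<close>.\<close>
  have conj: "p \<in> stab x \<longleftrightarrow> c \<otimes>\<^bsub>twist\<^esub> p \<otimes>\<^bsub>twist\<^esub> inv\<^bsub>twist\<^esub> c \<in> stab (\<alpha> (nf r c) x)"
    if x: "x \<in> topspace X" for p c x
  proof -
    have "\<alpha> (nf r (c \<otimes>\<^bsub>twist\<^esub> p \<otimes>\<^bsub>twist\<^esub> inv\<^bsub>twist\<^esub> c)) (\<alpha> (nf r c) x) = \<alpha> (nf r c) (\<alpha> (nf r p) x)"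
      by (simp only: action_mult action_closed x action_inv_left)
    then show ?thesis
      unfolding stab_def mem_Collect_eq using action_inv_left[OF x, of c] action_inv_left[OF action_closed[OF x], of c p]
      by metis
  qed
  have "bij_betw (\<alpha> (nf r (1, 0))) (?F (int i)) (?F (int i + 2))"
  proof (rule bij_betw_byWitness[where f' = "\<alpha> (nf r (- 1, 0))"])
    show "\<forall>x\<in>?F (int i). \<alpha> (nf r (- 1, 0)) (\<alpha> (nf r (1, 0)) x) = x"
      using action_inv_left[of _ "(1, 0)"] by simp
    show "\<forall>x\<in>?F (int i + 2). \<alpha> (nf r (1, 0)) (\<alpha> (nf r (- 1, 0)) x) = x"
      using action_inv_left[of _ "(- 1, 0)"] by simp
    show "\<alpha> (nf r (1, 0)) ` ?F (int i) \<subseteq> ?F (int i + 2)"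
      using conj[of _ "(int m, 0)" "(1, 0)"] conj[of _ "(int i, int j)" "(1, 0)"] assms
      by (auto simp: action_closed add.commute simp flip: add.assoc)
    show "\<alpha> (nf r (- 1, 0)) ` ?F (int i + 2) \<subseteq> ?F (int i)"
      using conj[of _ "(int m, 0)" "(- 1, 0)"] conj[of _ "(int i + 2, int j)" "(- 1, 0)"] assms
      by (auto simp: action_closed)
  qed
  then have "card (?F (int i)) = card (?F (int i + 2))" by (rule bij_betw_same_card)
  then show ?thesis by (simp add: flip_fix_def fixed_points_odd_type[OF assms] add.commute)
qed

text \<open>On points fixed by \<open>(m, 0)\<close>, multiplying \<open>(i, j)\<close> by
  \<open>(m, 0)\<close> does not change whether it fixes the point.\<close>

lemma flip_fix_add_m:
  assumes "odd j"
  shows "flip_fix j m (i + m) = flip_fix j m i"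
proof -
  have "(int (i + m), int j) \<in> stab x \<longleftrightarrow> (int i, int j) \<in> stab x"
    if x: "x \<in> topspace X" "(int m, 0) \<in> stab x" for x
  proof
    assume "(int i, int j) \<in> stab x"
    from subgroup.m_closed[OF subgroup_stab[OF x(1)] x(2) this]
    show "(int (i + m), int j) \<in> stab x" by (simp add: add.commute)
  next
    assume "(int (i + m), int j) \<in> stab x"
    from subgroup.m_closed[OF subgroup_stab[OF x(1)] subgroup.m_inv_closed[OF subgroup_stab[OF x(1)] x(2)] this]
    show "(int i, int j) \<in> stab x" by simp
  qed
  then show ?thesis
    unfolding flip_fix_def fixed_points_odd_type[OF assms] by (intro arg_cong[where f = card]) auto
qed

text \<open>Shifts by 2 leave only the parity of \<open>i\<close>. For odd \<open>m\<close> the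
  shift by \<open>m\<close> identifies the two parities and all \<open>m\<close> terms agree; for
  even \<open>m\<close> each parity occurs \<open>m / 2\<close> times. This is the case distinction
  in \<open>gen_fun_h\<close>.\<close>

lemma gen_fun_h_nth:
  assumes "odd j" "m > 0"
  shows "real m * gen_fun_h (subsystem X R (2 * j)) T (R ^^ j) $ m = (\<Sum>i<m. real (flip_fix j m i))"
proof (cases "odd m")
  case True
  have even: "flip_fix j m (2 * i + c) = flip_fix j m c" for i c
    by (induction i) (use flip_fix_add_2[OF assms(1), of m "2 * _ + c"] in \<open>simp_all add: ac_simps\<close>)
  obtain q where q: "m = 2 * q + 1" using True by (elim oddE)
  have "flip_fix j m 1 = flip_fix j m 0"
    using even[of q 1] flip_fix_add_m[OF assms(1), of m 0] q by simp
  then have "flip_fix j m i = flip_fix j m 0" for i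
    using even[of "i div 2" "i mod 2"] by (cases "even i") (auto simp: odd_iff_mod_2_eq_one)
  then have "(\<Sum>i<m. real (flip_fix j m i)) = (\<Sum>i<m. real (flip_fix j m 0))"
    by (intro sum.cong) auto
  then show ?thesis using True assms by (simp add: gen_fun_h_def flip_count_eq_flip_fix)
next
  case False
  have even: "flip_fix j m (2 * i + c) = flip_fix j m c" for i c
    by (induction i) (use flip_fix_add_2[OF assms(1), of m "2 * _ + c"] in \<open>simp_all add: ac_simps\<close>)
  obtain q where q: "m = 2 * q" using False by auto
  have "(\<Sum>i<2 * n. real (flip_fix j m i)) = real n * (real (flip_fix j m 0) + real (flip_fix j m 1))" for n
  proof (induction n)
    case (Suc n)
    then show ?case using even[of n 0] even[of n 1] by (simp add: algebra_simps)
  qed simp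
  then show ?thesis using False assms q by (simp add: gen_fun_h_def flip_count_eq_flip_fix)
qed

section \<open>The logarithm of the zeta function\<close>

text \<open>The index formulas \<open>n = 2 * k * m\<close> and \<open>n = j * m\<close> determine
  \<open>m\<close> from \<open>n\<close>, so the pairs \<open>(k, l)\<close> and
  \<open>(j, i)\<close> suffice as parameters.\<close>

lemma finite_index_subgroups_eq:
  assumes "n > 0"
  shows "{H. finite_index_subgroup (reversal_group r) H \<and> card (rcosets\<^bsub>reversal_group r\<^esub> H) = n} =
    (\<lambda>(k, l). nf r ` even_type (int k) (int (n div (2 * k))) (int l)) `
        (SIGMA k:{k. k dvd r \<and> 2 * k dvd n}. {..<k}) \<union>
    (\<lambda>(j, i). nf r ` odd_type (int j) (int (n div j)) (int i)) `
        (SIGMA j:{j. odd j \<and> j dvd r \<and> j dvd n}. {..<n div j})" (is "?L = ?A \<union> ?B")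
proof (intro equalityI subsetI)
  fix H assume "H \<in> ?L"
  then have H: "finite_index_subgroup (reversal_group r) H" "card (rcosets\<^bsub>reversal_group r\<^esub> H) = n" by auto
  show "H \<in> ?A \<union> ?B"
  proof (rule finite_index_subgroup_cases[OF H(1) r_pos])
    fix k m l
    assume *: "H = nf r ` even_type (int k) (int m) (int l)" "k > 0" "k dvd r" "m > 0" "l < k"
    then have "n = 2 * k * m" using even_type_index(2)[of k m r "int l"] H(2) by simp
    then show ?thesis using * by (intro UnI1 image_eqI[of _ _ "(k, l)"]) auto
  next
    fix j m i
    assume *: "H = nf r ` odd_type (int j) (int m) (int i)" "odd j" "j dvd r" "m > 0" "i < m"
    then have "n = j * m" using odd_type_index(2)[of j m r "int i"] H(2) by simp
    moreover have "j > 0" using * by (simp add: odd_pos)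
    ultimately show ?thesis using * by (intro UnI2 image_eqI[of _ _ "(j, i)"]) auto
  qed
next
  fix H assume "H \<in> ?A \<union> ?B"
  then show "H \<in> ?L"
  proof
    assume "H \<in> ?A"
    then obtain k l where *: "H = nf r ` even_type (int k) (int (n div (2 * k))) (int l)"
      "k dvd r" "2 * k dvd n" by auto
    obtain m where m: "n = 2 * k * m" using * by blast
    then have "k > 0" "m > 0" using assms by auto
    then show ?thesis using even_type_index[of k m r "int l"] * m by simp
  next
    assume "H \<in> ?B"
    then obtain j i where *: "H = nf r ` odd_type (int j) (int (n div j)) (int i)"
      "odd j" "j dvd r" "j dvd n" by auto
    obtain m where m: "n = j * m" using * by blast
    then have "j > 0" "m > 0" using assms by auto
    then show ?thesis using odd_type_index[of j m r "int i"] * m by simp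
  qed
qed

lemma nf_image_eq_iff:
  assumes "subgroup S twist" "subgroup S' twist" "(0, 2 * int r) \<in> S" "(0, 2 * int r) \<in> S'"
  shows "nf r ` S = nf r ` S' \<longleftrightarrow> S = S'"
proof
  assume "nf r ` S = nf r ` S'"
  then have "p \<in> S \<longleftrightarrow> p \<in> S'" for p
    using nf_mem_image_iff[of S r p] nf_mem_image_iff[of S' r p] assms by simp
  then show "S = S'" by blast
qed simp

lemma kernel_mem_even_type: "k dvd r \<Longrightarrow> (0, 2 * int r) \<in> even_type (int k) m l"
  unfolding even_type_iff by (elim dvdE, intro exI[of _ 0] exI[of _ "int (r div k)"]) (use r_pos in auto)

lemma kernel_mem_odd_type: "j dvd r \<Longrightarrow> (0, 2 * int r) \<in> odd_type (int j) m i"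
  unfolding odd_type_iff by (elim dvdE, intro exI[of _ 0] exI[of _ "2 * int (r div j)"]) (use r_pos in auto)

text \<open>Different parameters give different subgroups, within each family and across the two, so
  the sum over subgroups is reindexed without multiplicities.\<close>

lemma sum_finite_index_subgroups:
  fixes f :: "gen word set set \<Rightarrow> real"
  assumes "n > 0"
  shows "(\<Sum>H | finite_index_subgroup (reversal_group r) H \<and> card (rcosets\<^bsub>reversal_group r\<^esub> H) = n. f H) =
    (\<Sum>k | k dvd r \<and> 2 * k dvd n. \<Sum>l<k. f (nf r ` even_type (int k) (int (n div (2 * k))) (int l))) +
    (\<Sum>j | odd j \<and> j dvd r \<and> j dvd n. \<Sum>i<n div j. f (nf r ` odd_type (int j) (int (n div j)) (int i)))"
proof -
  define K where "K = {k. k dvd r \<and> 2 * k dvd n}"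
  define J where "J = {j. odd j \<and> j dvd r \<and> j dvd n}"
  define E where "E = (\<lambda>(k, l). nf r ` even_type (int k) (int (n div (2 * k))) (int l))"
  define D where "D = (\<lambda>(j, i). nf r ` odd_type (int j) (int (n div j)) (int i))"
  let ?A = "SIGMA k:K. {..<k}" and ?B = "SIGMA j:J. {..<n div j}"
  have fin: "finite K" "finite J"
    using finite_divisors_nat[OF r_pos] by (auto simp: K_def J_def)
  have injE: "inj_on E ?A"
  proof (rule inj_onI, clarify)
    fix k l k' l' assume *: "k \<in> K" "l < k" "k' \<in> K" "l' < k'" "E (k, l) = E (k', l')"
    then have "even_type (int k) (int (n div (2 * k))) (int l) = even_type (int k') (int (n div (2 * k'))) (int l')"
      unfolding E_def by (simp add: nf_image_eq_iff subgroup_even_type kernel_mem_even_type K_def)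
    moreover have "n div (2 * k) > 0" "n div (2 * k') > 0"
      using * assms by (auto simp: K_def dvd_div_eq_0_iff)
    ultimately show "k = k' \<and> l = l'" using * by (simp add: even_type_eq_iff)
  qed
  have injD: "inj_on D ?B"
  proof (rule inj_onI, clarify)
    fix j i j' i' assume *: "j \<in> J" "i < n div j" "j' \<in> J" "i' < n div j'" "D (j, i) = D (j', i')"
    then have "odd_type (int j) (int (n div j)) (int i) = odd_type (int j') (int (n div j')) (int i')"
      unfolding D_def by (simp add: nf_image_eq_iff subgroup_odd_type kernel_mem_odd_type J_def)
    moreover have "j > 0" "j' > 0" using * by (auto simp: J_def odd_pos)
    ultimately show "j = j' \<and> i = i'" using * by (simp add: odd_type_eq_iff)
  qed
  have disj: "E ` ?A \<inter> D ` ?B = {}"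
  proof -
    have "E (k, l) \<noteq> D (j, i)" if "k \<in> K" "j \<in> J" for k l j i
      using that even_type_neq_odd_type[of "int j"] unfolding E_def D_def
      by (simp add: nf_image_eq_iff subgroup_even_type subgroup_odd_type kernel_mem_even_type
          kernel_mem_odd_type K_def J_def)
    then show ?thesis by auto
  qed
  have "(\<Sum>H | finite_index_subgroup (reversal_group r) H \<and> card (rcosets\<^bsub>reversal_group r\<^esub> H) = n. f H) =
      sum f (E ` ?A) + sum f (D ` ?B)"
    unfolding finite_index_subgroups_eq[OF assms] K_def[symmetric] J_def[symmetric] E_def[symmetric] D_def[symmetric]
    by (rule sum.union_disjoint) (use fin disj in auto)
  also have "\<dots> = (\<Sum>p\<in>?A. f (E p)) + (\<Sum>p\<in>?B. f (D p))"
    by (simp add: sum.reindex[OF injE] sum.reindex[OF injD])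
  also have "\<dots> = (\<Sum>k\<in>K. \<Sum>l<k. f (E (k, l))) + (\<Sum>j\<in>J. \<Sum>i<n div j. f (D (j, i)))"
    using fin by (simp add: sum.Sigma)
  finally show ?thesis by (simp add: K_def J_def E_def D_def)
qed

section \<open>Comparison of coefficients\<close>

lemma lind_series_eq:
  "lind_series (reversal_group r) (topspace X) \<alpha> =
    (\<Sum>k | k dvd r \<and> 1 \<le> k \<and> k \<le> r. fps_const (1 / real (2 * k)) *
      (gen_fun_g k (subsystem X R (2 * k)) T R oo fps_X ^ (2 * k))) +
    (\<Sum>k | 1 \<le> k \<and> (2 * k - 1) dvd r \<and> 2 * k - 1 \<le> r. fps_const (1 / real (2 * k - 1)) *
      (gen_fun_h (subsystem X R (4 * k - 2)) T (R ^^ (2 * k - 1)) oo fps_X ^ (2 * k - 1)))"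
  (is "_ = ?G + ?H")
proof (rule fps_ext)
  fix n
  let ?f = "\<lambda>H. real (card (fixed_points (topspace X) \<alpha> H))"
  let ?h = "\<lambda>j. gen_fun_h (subsystem X R (2 * j)) T (R ^^ j)"
  have K: "{k. k dvd r \<and> 1 \<le> k \<and> k \<le> r} = {k. k dvd r}"
    using r_pos by (auto dest: dvd_imp_le intro: dvd_pos_nat Suc_leI)
  have fin: "finite {k. k dvd r}" "finite {j. odd j \<and> j dvd r}"
    using finite_divisors_nat[OF r_pos] by (auto intro: finite_subset)
  \<comment> \<open>The second sum is reindexed by the odd divisor \<open>j = 2 * k - 1\<close>, for
    which \<open>4 * k - 2 = 2 * j\<close>.\<close>
  have bij: "bij_betw (\<lambda>k. 2 * k - 1) {k. 1 \<le> k \<and> (2 * k - 1) dvd r \<and> 2 * k - 1 \<le> r} {j. odd j \<and> j dvd r}"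
  proof (rule bij_betw_byWitness[where f' = "\<lambda>j. (j + 1) div 2"])
    show "(\<lambda>j. (j + 1) div 2) ` {j. odd j \<and> j dvd r} \<subseteq> {k. 1 \<le> k \<and> (2 * k - 1) dvd r \<and> 2 * k - 1 \<le> r}"
      using r_pos by (auto elim!: oddE dest: dvd_imp_le)
  qed (auto elim!: oddE)
  have H: "?H = (\<Sum>j | odd j \<and> j dvd r. fps_const (1 / real j) * (?h j oo fps_X ^ j))"
    using sum.reindex_bij_betw[OF bij, of "\<lambda>j. fps_const (1 / real j) * (?h j oo fps_X ^ j)"]
    by (simp add: diff_mult_distrib2)
  show "lind_series (reversal_group r) (topspace X) \<alpha> $ n = (?G + ?H) $ n"
  proof (cases "n = 0")
    case True
    then show ?thesis
      unfolding H by (simp add: lind_series_def fps_sum_nth gen_fun_g_def gen_fun_h_def)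
  next
    case False
    \<comment> \<open>With \<open>n = 2 * k * m\<close>, the outer factor \<open>1 / (2 * k)\<close>
      and the factor \<open>1 / m\<close> inside \<open>gen_fun_g\<close> combine to the reciprocal
      of the index.\<close>
    have g: "(fps_const (1 / real (2 * k)) * (gen_fun_g k (subsystem X R (2 * k)) T R oo fps_X ^ (2 * k))) $ n =
      (if 2 * k dvd n then \<Sum>l<k. ?f (nf r ` even_type (int k) (int (n div (2 * k))) (int l)) / real n else 0)"
      if "k dvd r" for k
    proof (cases "2 * k dvd n")
      case True
      then obtain m where m: "n = 2 * k * m" by blast
      then have "k > 0" "m > 0" using False by auto
      then show ?thesis
        by (simp add: fps_nth_compose_X_power m gen_fun_g_def fixed_points_even_type sum_distrib_left)
    qed (simp add: fps_nth_compose_X_power)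
    have h: "(fps_const (1 / real j) * (?h j oo fps_X ^ j)) $ n =
      (if j dvd n then \<Sum>i<n div j. ?f (nf r ` odd_type (int j) (int (n div j)) (int i)) / real n else 0)"
      if "odd j" for j
    proof (cases "j dvd n")
      case True
      then obtain m where m: "n = j * m" by blast
      then have pos: "j > 0" "m > 0" using False by auto
      \<comment> \<open>Expanding by \<open>m\<close> brings in the sum of all \<open>m\<close> flip
        counts and turns the denominator into the index \<open>n = j * m\<close>.\<close>
      have "?h j $ m / real j = real m * ?h j $ m / real n" using pos m by simp
      also have "\<dots> = (\<Sum>i<m. ?f (nf r ` odd_type (int j) (int m) (int i)) / real n)"
        unfolding gen_fun_h_nth[OF that pos(2)] by (simp add: flip_fix_def sum_divide_distrib)
      finally show ?thesis using pos by (simp add: fps_nth_compose_X_power m)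
    qed (simp add: fps_nth_compose_X_power)
    have "lind_series (reversal_group r) (topspace X) \<alpha> $ n =
      (\<Sum>H | finite_index_subgroup (reversal_group r) H \<and> card (rcosets\<^bsub>reversal_group r\<^esub> H) = n. ?f H / real n)"
      unfolding lind_series_def by (auto intro!: sum.cong)
    also have "\<dots> = (\<Sum>k | k dvd r \<and> 2 * k dvd n. \<Sum>l<k.
        ?f (nf r ` even_type (int k) (int (n div (2 * k))) (int l)) / real n) +
      (\<Sum>j | odd j \<and> j dvd r \<and> j dvd n. \<Sum>i<n div j.
        ?f (nf r ` odd_type (int j) (int (n div j)) (int i)) / real n)"
      using False by (intro sum_finite_index_subgroups) simp
    also have "(\<Sum>k | k dvd r \<and> 2 * k dvd n. \<Sum>l<k.
        ?f (nf r ` even_type (int k) (int (n div (2 * k))) (int l)) / real n) = ?G $ n" (is "sum ?A _ = _")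
      unfolding K fps_sum_nth
      using sum.inter_filter[OF fin(1), of ?A "\<lambda>k. 2 * k dvd n"]
      by (subst sum.cong[OF HOL.refl g]) simp_all
    also have "(\<Sum>j | odd j \<and> j dvd r \<and> j dvd n. \<Sum>i<n div j.
        ?f (nf r ` odd_type (int j) (int (n div j)) (int i)) / real n) = ?H $ n" (is "sum ?B _ = _")
      unfolding H fps_sum_nth
      using sum.inter_filter[OF fin(2), of ?B "\<lambda>j. j dvd n"]
      by (subst sum.cong[OF HOL.refl h]) (simp_all add: conj_assoc)
    finally show ?thesis by simp
  qed
qed

end

theorem theoremA:
  fixes X :: "'a topology" and T R :: "'a \<Rightarrow> 'a" and r :: nat
    and \<alpha> :: "gen word set \<Rightarrow> 'a \<Rightarrow> 'a"
  assumes "r \<ge> 1"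
    and "reversal_system X T R"
    and "has_order X R (2 * r)"
    and "is_reversal_action r X T R \<alpha>"
    and "\<And>H. finite_index_subgroup (reversal_group r) H \<Longrightarrow> finite (fixed_points (topspace X) \<alpha> H)"
  shows "lind_zeta (reversal_group r) (topspace X) \<alpha> =
    (\<Prod>k | k dvd r \<and> 1 \<le> k \<and> k \<le> r.
      formal_exp (fps_const (1 / real (2 * k)) *
        (gen_fun_g k (subsystem X R (2 * k)) T R oo fps_X ^ (2 * k)))) *
    (\<Prod>k | 1 \<le> k \<and> (2 * k - 1) dvd r \<and> 2 * k - 1 \<le> r.
      formal_exp (fps_const (1 / real (2 * k - 1)) *
        (gen_fun_h (subsystem X R (4 * k - 2)) T (R ^^ (2 * k - 1)) oo fps_X ^ (2 * k - 1))))"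
proof -
  interpret reversal_action r X T R \<alpha>
    using assms by unfold_locales auto
  \<comment> \<open>Vanishing constant coefficients, which survive the substitution of powers of
    \<open>fps_X\<close>, are what allows \<open>formal_exp\<close> to turn the sums into
    products.\<close>
  have "gen_fun_g k Y T R $ 0 = 0" "gen_fun_h Y T F $ 0 = 0" for k Y F
    by (simp_all add: gen_fun_g_def gen_fun_h_def)
  then show ?thesis
    unfolding lind_zeta_def lind_series_eq
    by (simp add: formal_exp_add formal_exp_sum fps_sum_nth)
qed

end
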